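(* If $S\subseteq \mathbb Z$ is Bohr dense and $0\leq\delta<\frac{1}{2}$, then there is a subset $S'\subseteq S$ which is Bohr dense and $\delta$-nonrecurrent.
   Context: $\mathbb T=\mathbb R/\mathbb Z$ with the quotient topology. The Bohr topology of $\mathbb Z$ is the weakest topology on $\mathbb Z$ making all homomorphisms from $\mathbb Z$ into $\mathbb T$ continuous; a set $S\subseteq\mathbb Z$ is Bohr dense if it is dense in this topology. For $A\subseteq\mathbb Z$, $A-A:=\{a-b: a,b\in A\}$ and the upper Banach density of $A$ is $d^*(A):=\limsup_{n\to\infty}\sup_{k\in\mathbb Z}\frac{|A\cap\{k+1,\dots,k+n\}|}{n}$. For $\delta\geq 0$, a set $S\subseteq\mathbb Z$ is $\delta$-nonrecurrent if there is a set $A\subseteq\mathbb Z$ with $d^*(A)>\delta$ and $(A-A)\cap S=\varnothing$. *)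

theory Defs
  imports "HOL-Analysis.Analysis"
begin

quotient_type circle = real / "\<lambda>x y::real. x - y \<in> \<int>"
proof (rule equivpI)
  show "reflp (\<lambda>x y::real. x - y \<in> \<int>)"
    by (simp add: reflp_def)
  show "symp (\<lambda>x y::real. x - y \<in> \<int>)"
    by (metis (no_types, lifting) Ints_minus minus_diff_eq sympI)
  show "transp (\<lambda>x y::real. x - y \<in> \<int>)"
    by (rule transpI) (metis Ints_add diff_add_cancel add_diff_eq)
qed

instantiation circle :: ab_group_add
begin

lift_definition zero_circle :: circle is "0 :: real" .

lift_definition plus_circle :: "circle \<Rightarrow> circle \<Rightarrow> circle" is "(+) :: real \<Rightarrow> real \<Rightarrow> real"
  by (metis Ints_add add_diff_add)

lift_definition minus_circle :: "circle \<Rightarrow> circle \<Rightarrow> circle" is "(-) :: real \<Rightarrow> real \<Rightarrow> real"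
proof -
  fix a b c d :: real
  assume "a - b \<in> \<int>" "c - d \<in> \<int>"
  hence "(a - b) - (c - d) \<in> \<int>" by (rule Ints_diff)
  thus "(a - c) - (b - d) \<in> \<int>" by (simp add: algebra_simps)
qed

lift_definition uminus_circle :: "circle \<Rightarrow> circle" is "uminus :: real \<Rightarrow> real"
proof -
  fix a b :: real
  assume "a - b \<in> \<int>"
  hence "- (a - b) \<in> \<int>" by (rule Ints_minus)
  thus "- a - - b \<in> \<int>" by simp
qed

instance
  by standard (transfer; simp add: algebra_simps)+

end

instantiation circle :: topological_space
begin

text \<open>The quotient topology on $\mathbb{R}/\mathbb{Z}$: \<^const>\<open>abs_circle\<close> is the projection from the reals.\<close>

definition open_circle :: "circle set \<Rightarrow> bool" where
  "open_circle U \<longleftrightarrow> open (abs_circle -` U)"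

instance
  by standard (auto simp: open_circle_def vimage_Union)

end

text \<open>The preimages of open sets under all homomorphisms form a subbasis of the weakest topology
  making these homomorphisms continuous.\<close>

definition bohr_topology :: "int topology" where
  "bohr_topology = topology_generated_by {\<phi> -` U | \<phi> U. Modules.additive (\<phi> :: int \<Rightarrow> circle) \<and> open U}"

definition bohr_dense :: "int set \<Rightarrow> bool" where
  "bohr_dense S \<longleftrightarrow> bohr_topology closure_of S = UNIV"

text \<open>Stated in the extended reals, where the supremum and the limit superior always exist.
  The term for $n = 0$ is a division by zero, which does not affect the limit superior.\<close>

definition upper_banach_density :: "int set \<Rightarrow> ereal" where
  "upper_banach_density A =
     limsup (\<lambda>n. SUP k::int. ereal (real (card (A \<inter> {k+1..k + int n})) / real n))"

definition nonrecurrent :: "real \<Rightarrow> int set \<Rightarrow> bool" where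
  "nonrecurrent \<delta> S \<longleftrightarrow>
     (\<exists>A. upper_banach_density A > ereal \<delta> \<and> {a - b | a b. a \<in> A \<and> b \<in> A} \<inter> S = {})"

end

theory Submission
  imports Defs
begin

text \<open>A finite set \<open>F\<close> of integers is avoided by the differences of a set \<open>A\<close> that is periodic with an
  odd period \<open>m\<close> and has density above \<open>\<delta>\<close>; initially \<open>F = {1}\<close>. To enlarge \<open>F\<close>, choose many
  rationally independent frequencies \<open>\<gamma> i\<close> close to \<open>1 / m\<close> and let the point \<open>(n * \<gamma> i)\<^sub>i\<close> of the torus,
  with each coordinate rounded to a residue modulo \<open>2 * m\<close>, hold a plurality vote. A set \<open>B\<close> of residues
  built from two disjoint copies of \<open>A\<close> decides which winners are admitted. Shifting \<open>n\<close> by an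
  element of \<open>F\<close> rotates all votes alike, and \<open>B\<close> avoids this rotation. If \<open>s * \<gamma> i\<close> is close to
  \<open>1 / 2\<close> modulo \<open>1\<close> for all but \<open>r\<close> indices, then shifting by \<open>s\<close> rotates all but \<open>r\<close> votes
  by \<open>m\<close>, which \<open>B\<close> avoids too; for most points the margin of the winner exceeds \<open>2 * r\<close>, so the
  exceptional votes do not matter and almost no density is lost. Any \<open>r\<close> further frequencies can
  spoil the independence of at most \<open>r\<close> of the \<open>\<gamma> i\<close>, so by Kronecker's theorem such \<open>s\<close> meet every
  Bohr neighbourhood of rank \<open>r\<close>, and by compactness finitely many \<open>s \<in> S\<close> suffice. Replacing the
  \<open>\<gamma> i\<close> by rationals with a common odd denominator restores periodicity, and the
  construction is iterated with \<open>r \<rightarrow> \<infinity>\<close>.\<close>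

section \<open>Periodic sets\<close>

lemma periodic_shift:
  fixes m k :: int
  assumes "\<And>n. n + m \<in> A \<longleftrightarrow> n \<in> A"
  shows "n + m * k \<in> A \<longleftrightarrow> n \<in> A"
proof (induction k arbitrary: n rule: int_induct[where k = 0])
  case (step1 i)
  have "n + m * (i + 1) = (n + m * i) + m" by (simp add: algebra_simps)
  then show ?case using assms[of "n + m * i"] step1 by metis
next
  case (step2 i)
  have "(n + m * (i - 1)) + m = n + m * i" by (simp add: algebra_simps)
  then show ?case using assms[of "n + m * (i - 1)"] step2 by metis
qed simp

lemma periodic_mod:
  fixes m :: int
  assumes "\<And>n. n + m \<in> A \<longleftrightarrow> n \<in> A"
  shows "n mod m \<in> A \<longleftrightarrow> n \<in> A"
proof -
  have "n mod m + m * (n div m) = n" by simp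
  then show ?thesis using periodic_shift[OF assms, of "n mod m" "n div m"] by simp
qed

lemma periodic_cong:
  fixes m :: int
  assumes "\<And>n. n + m \<in> A \<longleftrightarrow> n \<in> A" and "n mod m = k mod m"
  shows "n \<in> A \<longleftrightarrow> k \<in> A"
  using periodic_mod[OF assms(1)] assms(2) by metis

text \<open>Reduction modulo \<open>m\<close> is a bijection between the two windows that respects
  membership in \<open>A\<close>; its inverse picks the representative in
  \<open>{x..<x + m}\<close>.\<close>

lemma card_periodic_window:
  fixes m x :: int
  assumes per: "\<And>n. n + m \<in> A \<longleftrightarrow> n \<in> A" and m: "m > 0"
  shows "card (A \<inter> {x..<x + m}) = card (A \<inter> {0..<m})"
proof (rule bij_betw_same_card[where f = "\<lambda>n. n mod m"], rule bij_betwI[where g = "\<lambda>n. x + (n - x) mod m"])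
  show "(\<lambda>n. n mod m) \<in> A \<inter> {x..<x + m} \<rightarrow> A \<inter> {0..<m}"
    using m periodic_mod[OF per] by auto
  have c: "(x + (n - x) mod m) mod m = n mod m" for n
    by (simp add: mod_add_right_eq)
  show "(\<lambda>n. x + (n - x) mod m) \<in> A \<inter> {0..<m} \<rightarrow> A \<inter> {x..<x + m}"
    using m periodic_cong[OF per c] by auto
  show "x + (n mod m - x) mod m = n" if "n \<in> A \<inter> {x..<x + m}" for n
  proof -
    have "(n mod m - x) mod m = (n - x) mod m" by (simp add: mod_diff_left_eq)
    also have "\<dots> = n - x" using that by (intro mod_pos_pos_trivial) auto
    finally show ?thesis by simp
  qed
  show "(x + (n - x) mod m) mod m = n" if "n \<in> A \<inter> {0..<m}" for n
    using that c by simp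
qed

text \<open>Even residues modulo \<open>2 * m\<close> carry a copy of \<open>A\<close>, odd residues a copy of its translate by \<open>1\<close>,
  which is disjoint from \<open>A\<close>; for odd \<open>m\<close> the shift by \<open>m\<close> interchanges the two copies.\<close>

lemma double_periodic_set:
  fixes m :: int
  assumes m: "m > 0" "odd m" and per: "\<And>n. n + m \<in> A \<longleftrightarrow> n \<in> A"
    and one: "\<And>n. n \<in> A \<Longrightarrow> n + 1 \<notin> A"
  obtains B where "\<And>n. n + 2 * m \<in> B \<longleftrightarrow> n \<in> B"
    "card (B \<inter> {0..<2 * m}) = 2 * card (A \<inter> {0..<m})"
    "\<And>n. n \<in> B \<Longrightarrow> n + m \<notin> B"
    "\<And>n s. (\<And>a. a \<in> A \<Longrightarrow> a + s \<notin> A) \<Longrightarrow> n \<in> B \<Longrightarrow> n + 2 * s \<notin> B"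
proof
  \<comment> \<open>The offset is \<open>m + 2\<close> and not \<open>m\<close>: adding
    \<open>m\<close> to \<open>2 * a\<close> gives the odd element attached to \<open>a - 1\<close>,
    and adding \<open>m\<close> to the odd element of \<open>a\<close> gives
    \<open>2 * (a + 1 + m)\<close>. Either clash would put two consecutive integers into
    \<open>A\<close>, up to its period.\<close>
  define B where "B = {2 * a | a. a \<in> A} \<union> {2 * a + m + 2 | a. a \<in> A}"
  have even_B: "2 * a \<in> B \<longleftrightarrow> a \<in> A" for a
    using m unfolding B_def by (auto, presburger)
  have odd_B: "2 * a + m + 2 \<in> B \<longleftrightarrow> a \<in> A" for a
    using m unfolding B_def by (auto, presburger)
  have cases: "\<exists>a. n = 2 * a \<or> n = 2 * a + m + 2" for n :: int
    using m by presburger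
  show perB: "n + 2 * m \<in> B \<longleftrightarrow> n \<in> B" for n
  proof -
    obtain a where "n = 2 * a \<or> n = 2 * a + m + 2" using cases by blast
    then show ?thesis
      using even_B[of "a + m"] odd_B[of "a + m"] even_B[of a] odd_B[of a] per[of a]
      by (auto simp: algebra_simps)
  qed
  show "n + m \<notin> B" if "n \<in> B" for n
  proof -
    from that obtain a where a: "a \<in> A" "n = 2 * a \<or> n = 2 * a + m + 2"
      unfolding B_def by blast
    show ?thesis
      using a(2)
    proof
      assume "n = 2 * a"
      then have "n + m = 2 * (a - 1) + m + 2" by simp
      then show ?thesis using odd_B[of "a - 1"] one[of "a - 1"] a by auto
    next
      assume "n = 2 * a + m + 2"
      then have eq: "n + m = 2 * (a + 1 + m)" by simp
      then show ?thesis unfolding eq even_B using one[of a] per[of "a + 1"] a by simp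
    qed
  qed
  show "n + 2 * s \<notin> B" if s: "\<And>a. a \<in> A \<Longrightarrow> a + s \<notin> A" and n: "n \<in> B" for n s
  proof -
    from n obtain a where a: "a \<in> A" "n = 2 * a \<or> n = 2 * a + m + 2"
      unfolding B_def by blast
    then show ?thesis
      using even_B[of "a + s"] odd_B[of "a + s"] s[of a] by (auto simp: algebra_simps)
  qed
  define E where "E = {n \<in> B. even n}"
  define D where "D = {n \<in> B. odd n}"
  have perD: "n + 2 * m \<in> D \<longleftrightarrow> n \<in> D" for n
    using perB by (auto simp: D_def)
  have "E \<inter> {0..<2 * m} = (\<lambda>a. 2 * a) ` (A \<inter> {0..<m})"
    using even_B by (auto simp: E_def elim!: evenE)
  then have "card (E \<inter> {0..<2 * m}) = card (A \<inter> {0..<m})"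
    by (simp add: card_image inj_on_def)
  \<comment> \<open>The odd elements are counted in a window starting at the offset, where
    \<open>a\<close> runs exactly through \<open>{0..<m}\<close>; periodicity moves the window back
    to \<open>0\<close>.\<close>
  moreover have "D \<inter> {m + 2..<m + 2 + 2 * m} = (\<lambda>a. 2 * a + m + 2) ` (A \<inter> {0..<m})"
  proof (intro equalityI subsetI)
    fix n assume n: "n \<in> D \<inter> {m + 2..<m + 2 + 2 * m}"
    then obtain a where a: "n = 2 * a \<or> n = 2 * a + m + 2" using cases by blast
    then have "n = 2 * a + m + 2" using n by (auto simp: D_def)
    then show "n \<in> (\<lambda>a. 2 * a + m + 2) ` (A \<inter> {0..<m})"
      using n odd_B[of a] by (intro image_eqI[of _ _ a]) (auto simp: D_def)
  next
    fix n assume "n \<in> (\<lambda>a. 2 * a + m + 2) ` (A \<inter> {0..<m})"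
    then show "n \<in> D \<inter> {m + 2..<m + 2 + 2 * m}"
      using odd_B m by (auto simp: D_def)
  qed
  then have "card (D \<inter> {m + 2..<m + 2 + 2 * m}) = card (A \<inter> {0..<m})"
    by (simp add: card_image inj_on_def)
  then have "card (D \<inter> {0..<2 * m}) = card (A \<inter> {0..<m})"
    using card_periodic_window[OF perD, of "m + 2"] m by simp
  moreover have "B \<inter> {0..<2 * m} = (E \<inter> {0..<2 * m}) \<union> (D \<inter> {0..<2 * m})"
    by (auto simp: E_def D_def)
  moreover have "card ((E \<inter> {0..<2 * m}) \<union> (D \<inter> {0..<2 * m}))
      = card (E \<inter> {0..<2 * m}) + card (D \<inter> {0..<2 * m})"
    by (rule card_Un_disjoint) (auto simp: E_def D_def)
  ultimately show "card (B \<inter> {0..<2 * m}) = 2 * card (A \<inter> {0..<m})" by simp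
qed

section \<open>Decisive plurality votes\<close>

text \<open>An entry \<open>x\<close> of a ballot is a vote for the candidate \<open>x div L\<close>. Each candidate owns a block of
  \<open>L\<close> cells, of which the last one is reserved as a buffer against rounding errors.\<close>

definition ballots :: "int \<Rightarrow> nat \<Rightarrow> int list set" where
  "ballots K N = {xs. set xs \<subseteq> {0..<K} \<and> length xs = N}"

definition votes :: "int \<Rightarrow> int \<Rightarrow> int list \<Rightarrow> nat" where
  "votes L p xs = length (filter (\<lambda>x. x div L = p) xs)"

text \<open>A margin above \<open>2 * r\<close> survives the alteration of any \<open>r\<close>
  votes, since one altered vote narrows a lead by at most 2.\<close>

definition wins :: "int \<Rightarrow> int \<Rightarrow> nat \<Rightarrow> int list \<Rightarrow> int \<Rightarrow> bool" where
  "wins M L r xs p \<longleftrightarrow>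
     p \<in> {0..<M} \<and> (\<forall>q\<in>{0..<M} - {p}. votes L q xs + 2 * r < votes L p xs)"

definition decisive :: "int \<Rightarrow> int \<Rightarrow> nat \<Rightarrow> nat \<Rightarrow> int list set" where
  "decisive M L r N =
     {xs \<in> ballots (M * L) N. (\<forall>x\<in>set xs. x mod L \<noteq> L - 1) \<and> (\<exists>p. wins M L r xs p)}"

lemma finite_ballots [simp]: "finite (ballots K N)"
  unfolding ballots_def by (rule finite_lists_length_eq) simp

lemma card_ballots: "card (ballots K N) = nat K ^ N"
  unfolding ballots_def by (subst card_lists_length_eq) simp_all

lemma ballots_Suc: "ballots K (Suc N) = (\<lambda>(x, xs). x # xs) ` ({0..<K} \<times> ballots K N)"
  by (auto simp: ballots_def length_Suc_conv image_iff)

lemma sum_ballots_Suc: "sum f (ballots K (Suc N)) = (\<Sum>x\<in>{0..<K}. \<Sum>xs\<in>ballots K N. f (x # xs))"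
  unfolding ballots_Suc
  by (subst sum.reindex) (auto simp: inj_on_def sum.cartesian_product case_prod_beta)

lemma block_in_range:
  fixes M L x :: int
  assumes "L > 0" "x \<in> {0..<M * L}"
  shows "x div L \<in> {0..<M}"
proof -
  have "x div L * L \<le> x"
    using assms div_mult_mod_eq[of x L] pos_mod_sign[of L x] by linarith
  also have "x < M * L" using assms by simp
  finally have "x div L < M" using assms by simp
  then show ?thesis using assms by (simp add: pos_imp_zdiv_nonneg_iff)
qed

lemma card_candidate:
  fixes M L p :: int
  assumes "L > 0" "p \<in> {0..<M}"
  shows "{x \<in> {0..<M * L}. x div L = p} = {p * L..<p * L + L}"
proof (intro equalityI subsetI)
  fix x assume x: "x \<in> {x \<in> {0..<M * L}. x div L = p}"
  then have "p * L + x mod L = x" using div_mult_mod_eq[of x L] by simp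
  then show "x \<in> {p * L..<p * L + L}"
    using assms pos_mod_sign[of L x] pos_mod_bound[of L x] by (simp, linarith)
next
  fix x assume x: "x \<in> {p * L..<p * L + L}"
  have "x div L = p"
    using x assms by (intro int_div_pos_eq[of _ _ _ "x - p * L"]) (auto simp: algebra_simps)
  moreover have "(p + 1) * L \<le> M * L" using assms by (intro mult_right_mono) auto
  moreover have "0 \<le> p * L" using assms by simp
  ultimately show "x \<in> {x \<in> {0..<M * L}. x div L = p}" using x by (auto simp: algebra_simps)
qed

definition lead :: "int \<Rightarrow> int \<Rightarrow> int \<Rightarrow> int list \<Rightarrow> real" where
  "lead L a b xs = real (votes L a xs) - real (votes L b xs)"

text \<open>For a uniformly random ballot the lead is a sum of independent steps, so its characteristic
  function is a power.\<close>

lemma sum_cos_lead: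
  fixes M L a b :: int and y c :: real
  assumes L: "L > 0" and ab: "a \<in> {0..<M}" "b \<in> {0..<M}" "a \<noteq> b"
  shows "(\<Sum>xs\<in>ballots (M * L) N. cos (y * (lead L a b xs + c)))
    = (of_int (M * L) * (1 - 2 / of_int M * (1 - cos y))) ^ N * cos (y * c)"
\<comment> \<open>The offset \<open>c\<close> has to vary because splitting off the first vote
  \<open>x\<close> shifts it by the step \<open>\<xi> x\<close>.\<close>
proof (induction N arbitrary: c)
  case 0
  have "ballots (M * L) 0 = {[]}" by (auto simp: ballots_def)
  then show ?case by (simp add: lead_def votes_def)
next
  case (Suc N)
  let ?P = "(of_int (M * L) * (1 - 2 / of_int M * (1 - cos y))) ^ N"
  define \<xi> :: "int \<Rightarrow> real" where "\<xi> x = of_bool (x div L = a) - of_bool (x div L = b)" for x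
  have lead_Cons: "lead L a b (x # xs) = lead L a b xs + \<xi> x" for x xs
    by (simp add: lead_def votes_def \<xi>_def)
  have M: "M > 0" using ab by auto
  let ?D = "cos (y * (c + 1)) - cos (y * c)"
  let ?E = "cos (y * (c - 1)) - cos (y * c)"
  have step: "cos (y * (\<xi> x + c)) = cos (y * c) + (if x div L = a then ?D else 0)
      + (if x div L = b then ?E else 0)" for x
    using ab(3) by (auto simp: \<xi>_def add.commute)
  have cd: "card {x \<in> {0..<M * L}. x div L = p} = nat L" if "p \<in> {0..<M}" for p
    by (subst card_candidate[OF L that]) simp
  have cd': "(\<Sum>x\<in>{0..<M * L}. if x div L = p then C else 0) = of_int L * C"
    if "p \<in> {0..<M}" for p and C :: real
    using L cd[OF that] by (subst sum.inter_filter[symmetric]) auto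
  have pos: "M * L > 0" using M L by simp
  have "(\<Sum>x\<in>{0..<M * L}. cos (y * (\<xi> x + c)))
      = of_int (M * L) * cos (y * c) + of_int L * ?D + of_int L * ?E"
    unfolding step sum.distrib cd'[OF ab(1)] cd'[OF ab(2)] using pos by simp
  also have "\<dots> = of_int (M * L) * (1 - 2 / of_int M * (1 - cos y)) * cos (y * c)"
  proof -
    \<comment> \<open>The steps \<open>1\<close> and \<open>-1\<close> are equally likely, so the
      sine parts of the addition formulas cancel and \<open>cos (y * c)\<close> factors out.\<close>
    have "?D + ?E = 2 * cos (y * c) * cos y - 2 * cos (y * c)"
      by (simp add: distrib_left right_diff_distrib cos_add cos_diff)
    then have DE: "of_int L * ?D + of_int L * ?E = of_int L * (2 * cos (y * c) * cos y - 2 * cos (y * c))"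
      by (metis distrib_left)
    have fac: "of_int (M * L) * (1 - 2 / of_int M * (1 - cos y))
        = of_int (M * L) - 2 * of_int L * (1 - cos y)"
      using M by (simp add: field_simps)
    have "of_int (M * L) * cos (y * c) + of_int L * (2 * cos (y * c) * cos y - 2 * cos (y * c))
        = (of_int (M * L) - 2 * of_int L * (1 - cos y)) * cos (y * c)"
      by (simp add: algebra_simps)
    then show ?thesis by (simp only: fac add.assoc DE)
  qed
  finally have key: "(\<Sum>x\<in>{0..<M * L}. cos (y * (\<xi> x + c)))
      = of_int (M * L) * (1 - 2 / of_int M * (1 - cos y)) * cos (y * c)" .
  have "(\<Sum>xs\<in>ballots (M * L) (Suc N). cos (y * (lead L a b xs + c)))
      = (\<Sum>x\<in>{0..<M * L}. \<Sum>xs\<in>ballots (M * L) N. cos (y * (lead L a b xs + (\<xi> x + c))))"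
    by (simp add: sum_ballots_Suc lead_Cons add.assoc)
  also have "\<dots> = (\<Sum>x\<in>{0..<M * L}. ?P * cos (y * (\<xi> x + c)))"
    by (simp only: Suc.IH)
  also have "\<dots> = ?P * (of_int (M * L) * (1 - 2 / of_int M * (1 - cos y)) * cos (y * c))"
    by (simp only: key flip: sum_distrib_left)
  finally show ?case by (simp add: mult_ac)
qed

text \<open>The double sum is the squared modulus of the exponential sum with terms
  \<open>exp (i * j * x / k)\<close>, split into real and imaginary part.\<close>

lemma fejer_nonneg:
  fixes x :: real
  shows "(\<Sum>j<k. \<Sum>l<k. cos ((real j - real l) / real k * x)) \<ge> 0"
proof -
  have "(\<Sum>j<k. \<Sum>l<k. cos ((real j - real l) / real k * x))
    = (\<Sum>j<k. cos (real j / real k * x))\<^sup>2 + (\<Sum>j<k. sin (real j / real k * x))\<^sup>2"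
    by (simp add: power2_eq_square sum_product flip: sum.distrib)
       (simp add: diff_divide_distrib left_diff_distrib cos_diff)
  then show ?thesis by simp
qed

lemma cos_pos_of_abs_le_1:
  fixes x :: real
  assumes "\<bar>x\<bar> \<le> 1"
  shows "cos x > 0"
  using assms pi_gt3 by (intro cos_gt_zero_pi) (auto simp: abs_le_iff)

text \<open>The Fejer kernel with frequencies in \<open>1 / k\<close> times the integers dominates the indicator of a
  single value; only its constant term, of size \<open>1 / k\<close>, survives in the limit \<open>N \<rightarrow> \<infinity>\<close>.\<close>

lemma card_lead_le:
  fixes M L a b :: int
  assumes L: "L > 0" and ab: "a \<in> {0..<M}" "b \<in> {0..<M}" "a \<noteq> b" and k: "k > 0"
  shows "real (card {xs \<in> ballots (M * L) N. lead L a b xs = c})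
    \<le> of_int (M * L) ^ N *
       ((\<Sum>j<k. \<Sum>l<k. (1 - 2 / of_int M * (1 - cos ((real j - real l) / real k))) ^ N) / (real k)\<^sup>2)"
proof -
  have M: "M \<ge> 2" using ab by auto
  let ?y = "\<lambda>j l. (real j - real l) / real k"
  let ?\<rho> = "\<lambda>y. 1 - 2 / real_of_int M * (1 - cos y)"
  \<comment> \<open>All frequencies have modulus at most 1, so their cosines are positive and, with
    \<open>M \<ge> 2\<close>, the bases of the powers are nonnegative. Hence the oscillating factor
    \<open>cos (?y j l * - c)\<close> can be bounded by 1 below.\<close>
  have rho: "0 \<le> ?\<rho> (?y j l)" if "j < k" "l < k" for j l
  proof -
    have "\<bar>?y j l\<bar> \<le> 1" using that by (auto simp: abs_le_iff field_simps)
    then have "cos (?y j l) \<ge> 0"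
      using cos_pos_of_abs_le_1 less_imp_le by blast
    then have "2 / of_int M * (1 - cos (?y j l)) \<le> 1 * 1"
      using M by (intro mult_mono) auto
    then show ?thesis by simp
  qed
  have "(real k)\<^sup>2 * real (card {xs \<in> ballots (M * L) N. lead L a b xs = c})
      = (\<Sum>xs\<in>ballots (M * L) N. if lead L a b xs = c then (real k)\<^sup>2 else 0)"
    by (subst sum.inter_filter[symmetric]) auto
  \<comment> \<open>Where the lead equals \<open>c\<close> every cosine is \<open>cos 0\<close>, so
    the kernel is the square of \<open>k\<close>; elsewhere it is nonnegative.\<close>
  also have "\<dots> \<le> (\<Sum>xs\<in>ballots (M * L) N. \<Sum>j<k. \<Sum>l<k. cos (?y j l * (lead L a b xs + - c)))"
    using fejer_nonneg by (intro sum_mono) (auto simp: power2_eq_square)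
  also have "\<dots> = (\<Sum>j<k. \<Sum>l<k. \<Sum>xs\<in>ballots (M * L) N. cos (?y j l * (lead L a b xs + - c)))"
    by (subst sum.swap, rule sum.cong[OF refl], rule sum.swap)
  also have "\<dots> = (\<Sum>j<k. \<Sum>l<k. (of_int (M * L) * ?\<rho> (?y j l)) ^ N * cos (?y j l * - c))"
    by (simp only: sum_cos_lead[OF L ab])
  also have "\<dots> \<le> (\<Sum>j<k. \<Sum>l<k. of_int (M * L) ^ N * ?\<rho> (?y j l) ^ N)"
  proof (intro sum_mono)
    fix j l assume jl: "j \<in> {..<k}" "l \<in> {..<k}"
    have "(of_int (M * L) * ?\<rho> (?y j l)) ^ N * cos (?y j l * - c)
        \<le> (of_int (M * L) * ?\<rho> (?y j l)) ^ N * 1"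
      using rho[of j l] jl M L by (intro mult_left_mono zero_le_power mult_nonneg_nonneg) auto
    then show "(of_int (M * L) * ?\<rho> (?y j l)) ^ N * cos (?y j l * - c)
        \<le> of_int (M * L) ^ N * ?\<rho> (?y j l) ^ N"
      by (simp only: power_mult_distrib mult_1_right)
  qed
  also have "\<dots> = of_int (M * L) ^ N * (\<Sum>j<k. \<Sum>l<k. ?\<rho> (?y j l) ^ N)"
    by (simp only: sum_distrib_left)
  finally show ?thesis using k by (simp add: field_simps)
qed

text \<open>Off the diagonal the base has modulus below 1 and its powers vanish; the
  \<open>k\<close> diagonal terms stay 1, and \<open>k\<close> divided by its square
  remains.\<close>

lemma fejer_average_tendsto:
  fixes M :: int
  assumes M: "M \<ge> 2" and k: "k > 0"
  shows "(\<lambda>N. (\<Sum>j<k. \<Sum>l<k. (1 - 2 / of_int M * (1 - cos ((real j - real l) / real k))) ^ N) / (real k)\<^sup>2)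
    \<longlonglongrightarrow> 1 / real k"
proof -
  let ?y = "\<lambda>j l. (real j - real l) / real k"
  let ?\<rho> = "\<lambda>y. 1 - 2 / real_of_int M * (1 - cos y)"
  have "(\<lambda>N. ?\<rho> (?y j l) ^ N) \<longlonglongrightarrow> (if j = l then 1 else 0)" if "j < k" "l < k" for j l
  proof (cases "j = l")
    case False
    have ne: "?y j l \<noteq> 0" using False k by simp
    have le: "\<bar>?y j l\<bar> < 1" using that by (auto simp: abs_less_iff field_simps)
    have c0: "cos (?y j l) > 0" using le by (intro cos_pos_of_abs_le_1) simp
    have "\<bar>?y j l\<bar> \<le> pi" using le pi_gt3 by linarith
    then have "cos \<bar>?y j l\<bar> < cos 0" using ne by (intro cos_monotone_0_pi) auto
    then have c1: "cos (?y j l) < 1" by (simp only: cos_abs_real cos_zero)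
    define u where "u = 1 - cos (?y j l)"
    have u: "0 < u" "u < 1" using c0 c1 by (auto simp: u_def)
    then have "2 / of_int M * u \<le> 1 * u" using M by (intro mult_right_mono) auto
    moreover have "2 / of_int M * u > 0" using M u by simp
    ultimately have "\<bar>?\<rho> (?y j l)\<bar> < 1" unfolding u_def[symmetric] using u by linarith
    then show ?thesis using False by (simp add: LIMSEQ_power_zero)
  qed simp
  then have "(\<lambda>N. (\<Sum>j<k. \<Sum>l<k. ?\<rho> (?y j l) ^ N) / (real k)\<^sup>2)
      \<longlonglongrightarrow> (\<Sum>j<k. \<Sum>l<k. if j = l then 1 else 0) / (real k)\<^sup>2"
    using k by (intro tendsto_divide tendsto_sum tendsto_const) auto
  moreover have "(\<Sum>j<k. \<Sum>l<k. if j = l then 1 else 0 :: real) = real k" by simp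
  ultimately show ?thesis using k by (simp add: power2_eq_square)
qed

text \<open>Union bound: a uniformly random entry is the last cell of its block with probability
  \<open>1 / L\<close>. In the induction either the first entry or the tail is at fault.\<close>

lemma card_garbage_le:
  fixes M L :: int
  assumes "L > 0" "M > 0"
  shows "real (card {xs \<in> ballots (M * L) N. \<exists>x\<in>set xs. x mod L = L - 1})
    \<le> real N / of_int L * of_int (M * L) ^ N"
proof (induction N)
  case 0
  then show ?case by (simp add: ballots_def)
next
  case (Suc N)
  let ?K = "M * L"
  let ?G = "{x \<in> {0..<?K}. x mod L = L - 1}"
  let ?B = "\<lambda>N. {xs \<in> ballots ?K N. \<exists>x\<in>set xs. x mod L = L - 1}"
  have "?G \<subseteq> (\<lambda>q. q * L + (L - 1)) ` {0..<M}"
  proof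
    fix x assume x: "x \<in> ?G"
    then have "x = x div L * L + (L - 1)" using div_mult_mod_eq[of x L] by simp
    moreover have "x div L \<in> {0..<M}"
      using x block_in_range[OF assms(1)] by blast
    ultimately show "x \<in> (\<lambda>q. q * L + (L - 1)) ` {0..<M}" by blast
  qed
  then have "card ?G \<le> card ((\<lambda>q. q * L + (L - 1)) ` {0..<M})" by (intro card_mono) auto
  also have "\<dots> \<le> nat M" using card_image_le[of "{0..<M}" "\<lambda>q. q * L + (L - 1)"] by simp
  finally have G: "real (card ?G) \<le> of_int M" using assms by (simp add: le_nat_iff)
  have "finite ?G" by (rule finite_subset[of _ "{0..<?K}"]) auto
  then have fin: "finite (?G \<times> ballots ?K N \<union> {0..<?K} \<times> ?B N)"
    by (intro finite_UnI finite_cartesian_product) auto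
  have "?B (Suc N) \<subseteq> (\<lambda>(x, xs). x # xs) ` (?G \<times> ballots ?K N \<union> {0..<?K} \<times> ?B N)"
  proof
    fix ys assume ys: "ys \<in> ?B (Suc N)"
    then obtain x xs where x: "ys = x # xs" "x \<in> {0..<?K}" "xs \<in> ballots ?K N"
      by (auto simp: ballots_Suc)
    then show "ys \<in> (\<lambda>(x, xs). x # xs) ` (?G \<times> ballots ?K N \<union> {0..<?K} \<times> ?B N)"
      using ys by (intro image_eqI[of _ _ "(x, xs)"]) auto
  qed
  then have "card (?B (Suc N)) \<le> card ((\<lambda>(x, xs). x # xs) ` (?G \<times> ballots ?K N \<union> {0..<?K} \<times> ?B N))"
    using fin by (intro card_mono) auto
  also have "\<dots> \<le> card (?G \<times> ballots ?K N \<union> {0..<?K} \<times> ?B N)"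
    using fin by (rule card_image_le)
  also have "\<dots> \<le> card (?G \<times> ballots ?K N) + card ({0..<?K} \<times> ?B N)" by (rule card_Un_le)
  also have "\<dots> = card ?G * nat ?K ^ N + nat ?K * card (?B N)"
    by (simp add: card_cartesian_product card_ballots)
  finally have "real (card (?B (Suc N))) \<le> real (card ?G * nat ?K ^ N + nat ?K * card (?B N))"
    by (rule of_nat_mono)
  also have "\<dots> = real (card ?G) * of_int ?K ^ N + of_int ?K * real (card (?B N))"
    using assms by simp
  also have "\<dots> \<le> of_int M * of_int ?K ^ N + of_int ?K * (real N / of_int L * of_int ?K ^ N)"
    using G Suc assms by (intro add_mono mult_mono mult_right_mono mult_left_mono) auto
  also have "\<dots> = real (Suc N) / of_int L * of_int ?K ^ Suc N"
    using assms by (simp add: field_simps)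
  finally show ?case .
qed

text \<open>On a ballot without buffer cells let \<open>p\<close> have the most votes. If
  \<open>p\<close> does not win, some rival is at most \<open>2 * r\<close> behind, so one of
  finitely many leads takes one of finitely many values.\<close>

lemma decisive_complement:
  fixes M L :: int
  assumes "M > 0"
  shows "ballots (M * L) N - decisive M L r N \<subseteq>
    {xs \<in> ballots (M * L) N. \<exists>x\<in>set xs. x mod L = L - 1} \<union>
    (\<Union>(a, b, d)\<in>{(a, b, d). a \<in> {0..<M} \<and> b \<in> {0..<M} \<and> a \<noteq> b \<and> d \<in> {-2 * int r..2 * int r}}.
       {xs \<in> ballots (M * L) N. lead L a b xs = of_int d})"
proof
  fix xs assume xs: "xs \<in> ballots (M * L) N - decisive M L r N"
  have "Max ((\<lambda>p. votes L p xs) ` {0..<M}) \<in> (\<lambda>p. votes L p xs) ` {0..<M}"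
    using assms by (intro Max_in) auto
  then obtain p where p: "p \<in> {0..<M}" and "votes L p xs = Max ((\<lambda>p. votes L p xs) ` {0..<M})"
    by auto
  then have max: "votes L q xs \<le> votes L p xs" if "q \<in> {0..<M}" for q
    using that by simp
  show "xs \<in> {xs \<in> ballots (M * L) N. \<exists>x\<in>set xs. x mod L = L - 1} \<union>
    (\<Union>(a, b, d)\<in>{(a, b, d). a \<in> {0..<M} \<and> b \<in> {0..<M} \<and> a \<noteq> b \<and> d \<in> {-2 * int r..2 * int r}}.
       {xs \<in> ballots (M * L) N. lead L a b xs = of_int d})"
  proof (cases "\<exists>x\<in>set xs. x mod L = L - 1")
    case False
    then have "\<not> wins M L r xs p" using xs by (auto simp: decisive_def)
    then obtain q where q: "q \<in> {0..<M}" "q \<noteq> p" "votes L p xs \<le> votes L q xs + 2 * r"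
      using p unfolding wins_def by (metis DiffE insertI1 not_less)
    define d where "d = int (votes L p xs) - int (votes L q xs)"
    have "d \<in> {-2 * int r..2 * int r}" using q max[of q] by (auto simp: d_def)
    moreover have "lead L p q xs = of_int d" by (simp add: lead_def d_def)
    ultimately show ?thesis using xs p q by blast
  qed (use xs in auto)
qed

text \<open>The parameters are chosen in the order \<open>k\<close>, \<open>N\<close>,
  \<open>L\<close>: the bound on close leads does not involve \<open>L\<close>, so \<open>L\<close>
  can be taken large compared with \<open>N\<close> to make buffer cells rare.\<close>

lemma exists_decisive:
  fixes M :: int and \<eta> :: real
  assumes M: "M \<ge> 2" and \<eta>: "\<eta> > 0"
  obtains N and L :: int where "L > 0" "(1 - \<eta>) * of_int (M * L) ^ N \<le> real (card (decisive M L r N))"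
proof -
  define T where "T = {(a, b, d). a \<in> {0..<M} \<and> b \<in> {0..<M} \<and> a \<noteq> b \<and> d \<in> {-2 * int r..2 * int r}}"
  have "T \<subseteq> {0..<M} \<times> {0..<M} \<times> {-2 * int r..2 * int r}" by (auto simp: T_def)
  then have T: "finite T" by (rule finite_subset) auto
  \<comment> \<open>One half of \<open>\<eta>\<close> is shared among the close leads indexed by
    \<open>T\<close>, the other half pays for buffer cells; the added 1 avoids a division by
    zero.\<close>
  define \<epsilon> where "\<epsilon> = \<eta> / (2 * (real (card T) + 1))"
  have \<epsilon>: "\<epsilon> > 0" using \<eta> by (simp add: \<epsilon>_def add_nonneg_pos)
  obtain k where k: "k > 0" "1 / real k < \<epsilon>"
    using \<epsilon> by (metis nat_approx_posE zero_less_Suc)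
  define \<beta> where "\<beta> N = (\<Sum>j<k. \<Sum>l<k. (1 - 2 / of_int M * (1 - cos ((real j - real l) / real k))) ^ N) / (real k)\<^sup>2" for N
  have "\<beta> \<longlonglongrightarrow> 1 / real k" unfolding \<beta>_def by (rule fejer_average_tendsto[OF M k(1)])
  then have "eventually (\<lambda>N. \<beta> N < \<epsilon>) sequentially" using k(2) by (rule order_tendstoD(2))
  then obtain N where N: "\<beta> N < \<epsilon>" by (auto simp: eventually_sequentially)
  obtain L' :: nat where L': "real N / (\<eta> / 2) < real L'" using reals_Archimedean2 by blast
  define L :: int where "L = int L' + 1"
  have L: "L > 0" by (simp add: L_def)
  have NL: "real N / of_int L \<le> \<eta> / 2"
    using L' \<eta> by (simp add: L_def field_simps)
  let ?K = "of_int (M * L) ^ N :: real"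
  let ?G = "{xs \<in> ballots (M * L) N. \<exists>x\<in>set xs. x mod L = L - 1}"
  let ?X = "\<lambda>(a, b, d). {xs \<in> ballots (M * L) N. lead L a b xs = of_int d}"
  have K: "?K > 0" using M L by simp
  have X: "real (card (?X t)) \<le> ?K * \<epsilon>" if "t \<in> T" for t
  proof -
    obtain a b d where t: "t = (a, b, d)" by (metis prod.exhaust)
    then have "real (card (?X t)) \<le> ?K * \<beta> N"
      using that card_lead_le[OF L, of a M b k N "of_int d"] k by (auto simp: T_def \<beta>_def)
    also have "\<dots> \<le> ?K * \<epsilon>" using N K by (intro mult_left_mono) auto
    finally show ?thesis .
  qed
  have "real (card (ballots (M * L) N)) = ?K"
    using M L by (simp add: card_ballots)
  moreover have "card (ballots (M * L) N) \<le> card (decisive M L r N) + card (?G \<union> (\<Union>t\<in>T. ?X t))"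
  proof -
    have "ballots (M * L) N \<subseteq> decisive M L r N \<union> (?G \<union> (\<Union>t\<in>T. ?X t))"
      using decisive_complement[of M L N r] M unfolding T_def by auto
    then have "card (ballots (M * L) N) \<le> card (decisive M L r N \<union> (?G \<union> (\<Union>t\<in>T. ?X t)))"
      using T by (intro card_mono) (auto simp: decisive_def)
    then show ?thesis using card_Un_le le_trans by blast
  qed
  moreover have "card (?G \<union> (\<Union>t\<in>T. ?X t)) \<le> card ?G + (\<Sum>t\<in>T. card (?X t))"
    using card_Un_le[of ?G "\<Union>t\<in>T. ?X t"] card_UN_le[OF T, of ?X] by linarith
  ultimately have "?K \<le> real (card (decisive M L r N)) + real (card ?G) + (\<Sum>t\<in>T. real (card (?X t)))"
    by (simp flip: of_nat_add of_nat_sum)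
  moreover have "real (card ?G) \<le> \<eta> / 2 * ?K"
    using card_garbage_le[of L M N] NL K M L by (smt (verit) mult_right_mono)
  moreover have "(\<Sum>t\<in>T. real (card (?X t))) \<le> real (card T) * (?K * \<epsilon>)"
    using X by (intro sum_bounded_above) auto
  moreover have "real (card T) * (?K * \<epsilon>) \<le> \<eta> / 2 * ?K"
    using \<eta> K by (simp add: \<epsilon>_def field_simps)
  ultimately have "(1 - \<eta>) * ?K \<le> real (card (decisive M L r N))" by (simp add: algebra_simps)
  then show ?thesis using that L by blast
qed

section \<open>Periodic sets from plurality votes\<close>

text \<open>The strict inequality makes the set of such \<open>x\<close> open, as the compactness
  argument and the rational approximation require.\<close>

definition near_integer :: "real \<Rightarrow> real \<Rightarrow> bool" where
  "near_integer x e \<longleftrightarrow> (\<exists>h::int. \<bar>x - of_int h\<bar> < e)"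

text \<open>Density is recorded as a count over one period. The period is kept odd so that a shift
  by \<open>m\<close> exchanges the parity classes modulo \<open>2 * m\<close>, on which the
  doubling of \<open>A\<close> rests.\<close>

definition modular_witness :: "real \<Rightarrow> int set \<Rightarrow> bool" where
  "modular_witness \<delta> F \<longleftrightarrow> (\<exists>m A. m > 0 \<and> odd m \<and> (\<forall>n. n + m \<in> A \<longleftrightarrow> n \<in> A) \<and>
     \<delta> * of_int m < real (card (A \<inter> {0..<m})) \<and> (\<forall>n\<in>A. \<forall>s\<in>F. n + s \<notin> A))"

text \<open>Both positions avoid the last cell of their block, so a discrepancy of at most one cell
  cannot change the block.\<close>

lemma block_shift:
  fixes M L x y c h d :: int
  assumes L: "L > 0" and y: "y = x + L * c + (M * L) * h + d" and d: "\<bar>d\<bar> \<le> 1"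
    and nx: "x mod L \<noteq> L - 1" and ny: "y mod L \<noteq> L - 1"
  shows "y div L = x div L + c + M * h"
proof -
  have "y = (x mod L + d) + L * (x div L + c + M * h)"
    using mult_div_mod_eq[of L x] by (simp add: y algebra_simps)
  then have dv: "y div L = (x mod L + d) div L + (x div L + c + M * h)"
    and md: "y mod L = (x mod L + d) mod L"
    using L by simp_all
  have x: "0 \<le> x mod L" "x mod L < L" using L by auto
  have "x mod L + d \<noteq> -1"
  proof
    assume "x mod L + d = -1"
    then have "y mod L = (-1) mod L" using md by simp
    then show False using L ny by (simp add: zmod_minus1)
  qed
  then have "0 \<le> x mod L + d" "x mod L + d < L" using x nx d by auto
  then show ?thesis using dv by simp
qed

text \<open>Modulo \<open>M * L\<close>, \<open>(M * L * n * g) div Q\<close> is the cell of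
  \<open>n * g / Q\<close> on a circle cut into \<open>M * L\<close> cells. A shift by
  \<open>s\<close> turns the circle by nearly \<open>c / M\<close>, that is by \<open>L * c\<close>
  cells, with an error below one cell; so the floors deviate by at most 1.\<close>

lemma near_div_shift:
  fixes K L M g Q n s c :: int
  assumes "M > 0" "L > 0" "Q > 0"
    and near: "near_integer (of_int s * (of_int g / of_int Q) - of_int c / of_int M) (1 / of_int (M * L))"
  obtains h d :: int where
    "(M * L * (n + s) * g) div Q = (M * L * n * g) div Q + L * c + (M * L) * h + d" "\<bar>d\<bar> \<le> 1"
proof -
  obtain h :: int where h: "\<bar>of_int s * (of_int g / of_int Q) - of_int c / of_int M - of_int h\<bar> < 1 / real_of_int (M * L)"
    using near by (auto simp: near_integer_def)
  define e where "e = of_int s * (of_int g / of_int Q) - of_int c / of_int M - real_of_int h"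
  define z where "z = real_of_int (M * L * n * g) / of_int Q"
  have "of_int (M * L) * \<bar>e\<bar> < 1"
    using h assms by (simp add: e_def field_simps)
  moreover have "of_int (M * L) * \<bar>e\<bar> = \<bar>of_int (M * L) * e\<bar>"
    using assms by (simp add: abs_mult)
  ultimately have Ke: "\<bar>of_int (M * L) * e\<bar> < 1" by simp
  have eq: "real_of_int (M * L * (n + s) * g) / of_int Q
      = z + of_int (M * L) * e + of_int (L * c + (M * L) * h)"
    using assms by (simp add: z_def e_def field_simps)
  have "(M * L * (n + s) * g) div Q = \<lfloor>z + of_int (M * L) * e + of_int (L * c + (M * L) * h)\<rfloor>"
    unfolding eq[symmetric] by (rule floor_divide_of_int_eq[symmetric])
  also have "\<dots> = \<lfloor>z + of_int (M * L) * e\<rfloor> + (L * c + (M * L) * h)" by (rule floor_add_int[symmetric])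
  finally have 1: "(M * L * (n + s) * g) div Q = \<lfloor>z + of_int (M * L) * e\<rfloor> + (L * c + (M * L) * h)" .
  have 2: "(M * L * n * g) div Q = \<lfloor>z\<rfloor>"
    unfolding z_def by (rule floor_divide_of_int_eq[symmetric])
  have "\<bar>\<lfloor>z + of_int (M * L) * e\<rfloor> - \<lfloor>z\<rfloor>\<bar> \<le> 1" using Ke by linarith
  then show ?thesis
    using that[of h "\<lfloor>z + of_int (M * L) * e\<rfloor> - \<lfloor>z\<rfloor>"] 1 2 by simp
qed

lemma votes_eq_card: "votes L p xs = card {i. i < length xs \<and> (xs ! i) div L = p}"
  by (simp add: votes_def length_filter_conv_card)

lemma votes_le_shift:
  assumes len: "length xs = N" "length ys = N" and r: "card {i. i < N \<and> \<not> R i} \<le> r"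
    and *: "\<And>i. i < N \<Longrightarrow> R i \<Longrightarrow> xs ! i div L = p \<Longrightarrow> ys ! i div L = q"
  shows "votes L p xs \<le> votes L q ys + r"
proof -
  have "{i. i < N \<and> xs ! i div L = p} \<subseteq> {i. i < N \<and> ys ! i div L = q} \<union> {i. i < N \<and> \<not> R i}"
    using * by blast
  then have "card {i. i < N \<and> xs ! i div L = p}
      \<le> card ({i. i < N \<and> ys ! i div L = q} \<union> {i. i < N \<and> \<not> R i})"
    by (intro card_mono) auto
  also have "\<dots> \<le> card {i. i < N \<and> ys ! i div L = q} + card {i. i < N \<and> \<not> R i}"
    by (rule card_Un_le)
  finally show ?thesis using len r by (simp add: votes_eq_card)
qed

text \<open>Otherwise let \<open>p'\<close> be the candidate that the rotation takes to
  \<open>q\<close>. Then \<open>p\<close> beats \<open>p'\<close> on \<open>xs\<close> and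
  \<open>q\<close> beats the rotated \<open>p\<close> on \<open>ys\<close>, each by more than
  \<open>2 * r\<close>. But all but \<open>r\<close> of the votes for \<open>p\<close> reappear for
  the rotated \<open>p\<close>, and all but \<open>r\<close> of those for \<open>q\<close> come from
  \<open>p'\<close>.\<close>

lemma wins_shift:
  fixes M L c :: int
  assumes M: "M > 0" and len: "length xs = N" "length ys = N"
    and r: "card {i. i < N \<and> \<not> R i} \<le> r"
    and shift: "\<And>i. i < N \<Longrightarrow> R i \<Longrightarrow> ys ! i div L = (xs ! i div L + c) mod M"
    and range: "\<And>i. i < N \<Longrightarrow> xs ! i div L \<in> {0..<M}"
    and p: "wins M L r xs p" and q: "wins M L r ys q"
  shows "q = (p + c) mod M"
proof (rule ccontr)
  assume ne: "q \<noteq> (p + c) mod M"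
  have pM: "p \<in> {0..<M}" and qM: "q \<in> {0..<M}" using p q by (auto simp: wins_def)
  define p' where "p' = (q - c) mod M"
  have p'M: "p' \<in> {0..<M}" using M by (simp add: p'_def)
  have "p' \<noteq> p"
  proof
    assume "p' = p"
    then have "(p + c) mod M = q mod M" unfolding p'_def by (metis diff_add_cancel mod_add_left_eq)
    then show False using ne qM by simp
  qed
  then have 1: "votes L p' xs + 2 * r < votes L p xs" using p p'M by (auto simp: wins_def)
  have 2: "votes L ((p + c) mod M) ys + 2 * r < votes L q ys"
    using q M ne by (auto simp: wins_def)
  have 3: "votes L p xs \<le> votes L ((p + c) mod M) ys + r"
    by (rule votes_le_shift[OF len r]) (use shift in auto)
  have 4: "votes L q ys \<le> votes L p' xs + r"
  proof (rule votes_le_shift[OF len(2,1) r])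
    fix i assume i: "i < N" "R i" "ys ! i div L = q"
    then have "q = (xs ! i div L + c) mod M" using shift by simp
    then have "p' = (xs ! i div L) mod M" unfolding p'_def by (simp add: mod_diff_left_eq)
    then show "xs ! i div L = p'" using range[OF i(1)] by simp
  qed
  show False using 1 2 3 4 by linarith
qed

text \<open>The orbit point with coordinates \<open>n * g i / Q\<close> on the
  \<open>N\<close>-dimensional torus, each coordinate rounded down to one of \<open>K\<close> cells
  and then translated by \<open>t\<close>.\<close>

definition position :: "int \<Rightarrow> int \<Rightarrow> (nat \<Rightarrow> int) \<Rightarrow> nat \<Rightarrow> int \<Rightarrow> int list \<Rightarrow> int list" where
  "position K Q g N n t = map (\<lambda>i. ((K * n * g i) div Q + t ! i) mod K) [0..<N]"

lemma position_ballots: "K > 0 \<Longrightarrow> position K Q g N n t \<in> ballots K N"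
  by (auto simp: position_def ballots_def)

text \<open>For fixed \<open>n\<close> this is a translation of the \<open>N\<close>-fold power of
  the integers modulo \<open>K\<close>, so a uniformly random \<open>t\<close> gives a uniformly
  random ballot, whatever \<open>n\<close> is.\<close>

lemma bij_betw_position:
  assumes "K > 0"
  shows "bij_betw (position K Q g N n) (ballots K N) (ballots K N)"
  unfolding bij_betw_def
proof
  show inj: "inj_on (position K Q g N n) (ballots K N)"
  proof (rule inj_onI, rule nth_equalityI)
    fix t u assume tu: "t \<in> ballots K N" "u \<in> ballots K N" and eq: "position K Q g N n t = position K Q g N n u"
    show "length t = length u" using tu by (simp add: ballots_def)
    fix i assume "i < length t"
    then have i: "i < N" using tu by (simp add: ballots_def)
    have "((K * n * g i) div Q + t ! i) mod K = ((K * n * g i) div Q + u ! i) mod K"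
      using arg_cong[OF eq, of "\<lambda>xs. xs ! i"] i by (simp add: position_def)
    then have "(t ! i) mod K = (u ! i) mod K"
      by (metis add_diff_cancel_left' mod_diff_left_eq)
    moreover have "t ! i \<in> set t" "u ! i \<in> set u" using tu i by (simp_all add: ballots_def)
    then have "t ! i \<in> {0..<K}" "u ! i \<in> {0..<K}" using tu unfolding ballots_def by blast+
    ultimately show "t ! i = u ! i" by simp
  qed
  show "position K Q g N n ` ballots K N = ballots K N"
    using inj position_ballots[OF assms] by (intro endo_inj_surj) auto
qed

lemma position_periodic:
  assumes "Q > 0"
  shows "position K Q g N (n + Q) t = position K Q g N n t"
proof -
  have "(K * (n + Q) * g i) div Q = (K * n * g i) div Q + K * g i" for i
  proof -
    have "K * (n + Q) * g i = K * n * g i + Q * (K * g i)" by (simp add: algebra_simps)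
    then show ?thesis using assms by simp
  qed
  moreover have "(a + K * b + c) mod K = (a + c) mod K" for a b c :: int
    by (metis add.commute add.left_commute mod_mult_self2)
  ultimately show ?thesis by (simp add: position_def)
qed

text \<open>The translation \<open>t\<close> of the torus and the rotation \<open>c\<close> of the candidates are chosen by averaging,
  which makes equidistribution of the orbit unnecessary.\<close>

lemma modular_witness_plurality:
  fixes M L Q :: int and g :: "nat \<Rightarrow> int"
  assumes M: "M > 0" and L: "L > 0" and Q: "Q > 0" "odd Q"
    and perB: "\<And>n. n + M \<in> B \<longleftrightarrow> n \<in> B"
    and dens: "\<delta> * (of_int M * of_int (M * L) ^ N)
      < real (card (B \<inter> {0..<M})) * real (card (decisive M L r N))"
    and F: "\<And>s. s \<in> F \<Longrightarrow> \<exists>c. (\<forall>b\<in>B. b + c \<notin> B) \<and>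
      card {i. i < N \<and> \<not> near_integer (of_int s * (of_int (g i) / of_int Q) - of_int c / of_int M) (1 / of_int (M * L))} \<le> r"
  shows "modular_witness \<delta> F"
proof -
  let ?K = "M * L"
  have K: "?K > 0" using M L by simp
  let ?w = "position ?K Q g N"
  define A where "A t c = {n. \<exists>p. wins M L r (?w n t) p \<and> p - c \<in> B \<and> ?w n t \<in> decisive M L r N}" for t c
  have wins_unique: "p = q" if "wins M L r xs p" "wins M L r xs q" for xs p q
  proof (rule ccontr)
    assume "p \<noteq> q"
    then have "votes L q xs + 2 * r < votes L p xs" "votes L p xs + 2 * r < votes L q xs"
      using that by (auto simp: wins_def)
    then show False by linarith
  qed
  have perA: "n + Q \<in> A t c \<longleftrightarrow> n \<in> A t c" for n t c
    unfolding A_def using position_periodic[OF Q(1)] by simp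
  have avoid: "n + s \<notin> A t c" if "n \<in> A t c" "s \<in> F" for n s t c
  proof
    assume "n + s \<in> A t c"
    obtain e where e: "\<And>b. b \<in> B \<Longrightarrow> b + e \<notin> B"
      and card: "card {i. i < N \<and> \<not> near_integer (of_int s * (of_int (g i) / of_int Q) - of_int e / of_int M) (1 / of_int (M * L))} \<le> r"
      using F[OF \<open>s \<in> F\<close>] by blast
    obtain p where p: "wins M L r (?w n t) p" "p - c \<in> B" "?w n t \<in> decisive M L r N"
      using \<open>n \<in> A t c\<close> by (auto simp: A_def)
    obtain q where q: "wins M L r (?w (n + s) t) q" "q - c \<in> B" "?w (n + s) t \<in> decisive M L r N"
      using \<open>n + s \<in> A t c\<close> by (auto simp: A_def)
    have len: "length (?w k t) = N" for k by (simp add: position_def)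
    have range: "xs ! i div L \<in> {0..<M}" if "xs \<in> ballots ?K N" "i < N" for xs i
    proof -
      have "xs ! i \<in> {0..<?K}" using that nth_mem unfolding ballots_def by blast
      then show ?thesis by (rule block_in_range[OF L])
    qed
    have "q = (p + e) mod M"
    proof (rule wins_shift[OF M len len card _ _ p(1) q(1)])
      fix i assume i: "i < N"
      show "?w n t ! i div L \<in> {0..<M}" by (rule range[OF position_ballots[OF K] i])
      assume near: "near_integer (of_int s * (of_int (g i) / of_int Q) - of_int e / of_int M) (1 / of_int (M * L))"
      obtain h d where hd: "(M * L * (n + s) * g i) div Q = (M * L * n * g i) div Q + L * e + (M * L) * h + d" "\<bar>d\<bar> \<le> 1"
        by (rule near_div_shift[OF M L Q(1) near])
      let ?x = "?w n t ! i" and ?y = "?w (n + s) t ! i"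
      let ?a = "(?K * n * g i) div Q + t ! i" and ?b = "(?K * (n + s) * g i) div Q + t ! i"
      have xy: "?x = ?a mod ?K" "?y = ?b mod ?K" using i by (simp_all add: position_def)
      \<comment> \<open>Both reductions modulo \<open>?K\<close> go into the multiple of
        \<open>?K\<close>, which changes the block number by a multiple of \<open>M\<close>
        only.\<close>
      have "?y = ?x + L * e + ?K * (?a div ?K + h - ?b div ?K) + d"
      proof -
        have "?b = ?a + L * e + ?K * h + d" using hd(1) by simp
        moreover have "?x = ?a - ?K * (?a div ?K)" "?y = ?b - ?K * (?b div ?K)"
          unfolding xy by (simp_all only: minus_mult_div_eq_mod)
        ultimately show ?thesis by (simp only: distrib_left right_diff_distrib)
      qed
      moreover have "?x mod L \<noteq> L - 1" "?y mod L \<noteq> L - 1"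
      proof -
        have "?x \<in> set (?w n t)" "?y \<in> set (?w (n + s) t)" using i len by simp_all
        then show "?x mod L \<noteq> L - 1" "?y mod L \<noteq> L - 1"
          using p(3) q(3) by (auto simp only: decisive_def mem_Collect_eq)
      qed
      ultimately have "?y div L = ?x div L + e + M * (?a div ?K + h - ?b div ?K)"
        by (intro block_shift[OF L _ hd(2)])
      then have "?y div L mod M = (?x div L + e) mod M" by simp
      then show "?y div L = (?x div L + e) mod M"
        using range[OF position_ballots[OF K] i, of Q g "n + s" t] by simp
    qed
    then have "(q - c) mod M = (p + e - c) mod M" by (simp add: mod_diff_left_eq)
    then have "(p - c + e) mod M = (q - c) mod M" by (simp add: algebra_simps)
    then show False using periodic_cong[OF perB] e[OF p(2)] q(2) by blast
  qed
  \<comment> \<open>The number of good pairs \<open>(t, c)\<close> is the same for every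
    \<open>n\<close>: the position runs through all ballots, and for a decisive one with winner
    \<open>p\<close> the values \<open>p - c\<close> run through one full period of
    \<open>B\<close>.\<close>
  have count: "(\<Sum>t\<in>ballots ?K N. \<Sum>c\<in>{0..<M}. of_bool (n \<in> A t c))
      = card (decisive M L r N) * card (B \<inter> {0..<M})" (is "?lhs = _") for n
  proof -
    have inner: "(\<Sum>c\<in>{0..<M}. of_bool (n \<in> A t c))
        = (if ?w n t \<in> decisive M L r N then card (B \<inter> {0..<M}) else 0)" for t
    proof (cases "?w n t \<in> decisive M L r N")
      case True
      then obtain p where p: "wins M L r (?w n t) p" by (auto simp: decisive_def)
      have "n \<in> A t c \<longleftrightarrow> p - c \<in> B" for c
        using True p wins_unique by (auto simp: A_def)
      then have "(\<Sum>c\<in>{0..<M}. of_bool (n \<in> A t c)) = card {c \<in> {0..<M}. p - c \<in> B}"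
        by (simp add: Int_def)
      also have "{c \<in> {0..<M}. p - c \<in> B} = (\<lambda>b. p - b) ` (B \<inter> {p - M + 1..<p - M + 1 + M})"
        by (auto simp: image_iff intro!: bexI[of _ "p - c" for c])
      also have "card \<dots> = card (B \<inter> {0..<M})"
        using card_periodic_window[OF perB M, of "p - M + 1"]
        by (subst card_image) (simp_all add: inj_on_def)
      finally show ?thesis using True by simp
    qed (simp add: A_def)
    have "?lhs = (\<Sum>t\<in>ballots ?K N. (\<lambda>xs. if xs \<in> decisive M L r N then card (B \<inter> {0..<M}) else 0) (?w n t))"
      by (simp only: inner)
    also have "\<dots> = (\<Sum>xs\<in>ballots ?K N. if xs \<in> decisive M L r N then card (B \<inter> {0..<M}) else 0)"
      by (rule sum.reindex_bij_betw[OF bij_betw_position[OF K]])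
    also have "\<dots> = card (decisive M L r N) * card (B \<inter> {0..<M})"
      by (subst sum.inter_restrict[symmetric]) (auto simp: decisive_def Int_def)
    finally show ?thesis .
  qed
  \<comment> \<open>Averaging: if every pair \<open>(t, c)\<close> failed, the double count of
    triples \<open>(n, t, c)\<close> over one period \<open>Q\<close> would contradict
    \<open>dens\<close>.\<close>
  have "\<exists>t\<in>ballots ?K N. \<exists>c\<in>{0..<M}. \<delta> * of_int Q < real (card (A t c \<inter> {0..<Q}))"
  proof (rule ccontr)
    assume "\<not> ?thesis"
    then have le: "real (card (A t c \<inter> {0..<Q})) \<le> \<delta> * of_int Q" if "t \<in> ballots ?K N" "c \<in> {0..<M}" for t c
      using that by (auto simp: not_less)
    have cardA: "card (A t c \<inter> {0..<Q}) = (\<Sum>n\<in>{0..<Q}. of_bool (n \<in> A t c))" for t c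
      by (simp add: Int_commute)
    have "(\<Sum>t\<in>ballots ?K N. \<Sum>c\<in>{0..<M}. card (A t c \<inter> {0..<Q}))
        = (\<Sum>t\<in>ballots ?K N. \<Sum>n\<in>{0..<Q}. \<Sum>c\<in>{0..<M}. of_bool (n \<in> A t c))"
      unfolding cardA by (intro sum.cong refl sum.swap)
    also have "\<dots> = (\<Sum>n\<in>{0..<Q}. \<Sum>t\<in>ballots ?K N. \<Sum>c\<in>{0..<M}. of_bool (n \<in> A t c))"
      by (rule sum.swap)
    also have "\<dots> = nat Q * (card (decisive M L r N) * card (B \<inter> {0..<M}))"
      by (simp only: count) simp
    finally have "real (nat Q * (card (decisive M L r N) * card (B \<inter> {0..<M})))
        = (\<Sum>t\<in>ballots ?K N. \<Sum>c\<in>{0..<M}. real (card (A t c \<inter> {0..<Q})))"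
      by (simp only: flip: of_nat_sum)
    also have "\<dots> \<le> (\<Sum>t\<in>ballots ?K N. \<Sum>c\<in>{0..<M}. \<delta> * of_int Q)"
      using le by (intro sum_mono) auto
    also have "\<dots> = of_int Q * (\<delta> * (of_int M * of_int ?K ^ N))"
      using M K by (simp add: card_ballots)
    also have "\<dots> < of_int Q * (real (card (B \<inter> {0..<M})) * real (card (decisive M L r N)))"
      using dens Q by (intro mult_strict_left_mono) auto
    finally show False using Q by (simp add: mult_ac)
  qed
  then obtain t c where "\<delta> * of_int Q < real (card (A t c \<inter> {0..<Q}))" by blast
  then show ?thesis
    unfolding modular_witness_def
    by (intro exI[of _ Q] exI[of _ "A t c"]) (simp add: Q perA avoid)
qed

section \<open>Simultaneous approximation\<close>

interpretation rat_real: vector_space "\<lambda>(q::rat) (x::real). of_rat q * x"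
  by unfold_locales (simp_all add: algebra_simps of_rat_add of_rat_mult)

lemma countable_rat_span:
  assumes "finite X"
  shows "countable (rat_real.span X)"
  using assms
proof (induction X rule: finite_induct)
  case (insert a X)
  have "rat_real.span (insert a X) \<subseteq> (\<Union>q. (\<lambda>y. y + of_rat q * a) ` rat_real.span X)"
    unfolding rat_real.span_insert by (auto simp: image_iff) (metis diff_add_cancel)
  then show ?case by (rule countable_subset) (use insert.IH in auto)
qed simp

text \<open>Greedy choice: the rational span of finitely many reals is countable, so it cannot
  exhaust an interval.\<close>

lemma exists_rat_independent:
  fixes a b :: real
  assumes "a < b"
  obtains \<gamma> :: "nat \<Rightarrow> real" where "\<And>i. i < N \<Longrightarrow> a < \<gamma> i \<and> \<gamma> i < b"
    "inj_on \<gamma> {..<N}" "1 \<notin> \<gamma> ` {..<N}" "rat_real.independent (insert 1 (\<gamma> ` {..<N}))"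
proof -
  have "\<exists>G\<subseteq>{a<..<b}. finite G \<and> card G = N \<and> 1 \<notin> G \<and> rat_real.independent (insert 1 G)"
  proof (induction N)
    case 0
    show ?case by (intro exI[of _ "{}"]) (simp add: rat_real.independent_insert)
  next
    case (Suc N)
    then obtain G where G: "G \<subseteq> {a<..<b}" "finite G" "card G = N" "1 \<notin> G" "rat_real.independent (insert 1 G)"
      by blast
    have "countable (rat_real.span (insert 1 G))" using G by (intro countable_rat_span) simp
    then obtain x where x: "x \<in> {a<..<b}" "x \<notin> rat_real.span (insert 1 G)"
      using uncountable_open_interval[of a b] assms by (meson countable_subset subsetI)
    then have "x \<notin> insert 1 G" using rat_real.span_base by blast
    moreover have "rat_real.independent (insert x (insert 1 G))"
      using x(2) G(5) by (rule rat_real.independent_insertI)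
    ultimately show ?case
      using x G by (intro exI[of _ "insert x G"]) (auto simp: insert_commute)
  qed
  then obtain G where G: "G \<subseteq> {a<..<b}" "finite G" "card G = N" "1 \<notin> G" "rat_real.independent (insert 1 G)"
    by blast
  then obtain \<gamma> where "bij_betw \<gamma> {0..<N} G" using ex_bij_betw_nat_finite by blast
  then have "inj_on \<gamma> {..<N}" "\<gamma> ` {..<N} = G" by (auto simp: bij_betw_def lessThan_atLeast0)
  then show ?thesis using G that[of \<gamma>] by fastforce
qed

text \<open>Bridges to \<open>Kronecker_thm_2\<close>, whose hypothesis is independence over the
  integers.\<close>

lemma int_independent_if_rat_independent:
  assumes "rat_real.independent X"
  shows "module.independent (\<lambda>r x. real_of_int r * x) X"
proof -
  interpret Z: Modules.module "\<lambda>r x. real_of_int r * x"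
    by unfold_locales (simp_all add: algebra_simps)
  show ?thesis
    unfolding Z.independent_explicit_module
  proof (intro allI impI)
    fix t and u :: "real \<Rightarrow> int" and v
    assume "finite t" "t \<subseteq> X" "(\<Sum>v\<in>t. real_of_int (u v) * v) = 0" "v \<in> t"
    then have "rat_of_int (u v) = 0"
      using rat_real.independentD[OF assms, of t "\<lambda>v. of_int (u v)" v] by simp
    then show "u v = 0" by simp
  qed
qed

lemma Kronecker_set:
  fixes B :: "real set" and \<tau> :: "real \<Rightarrow> real"
  assumes B: "finite B" "1 \<notin> B" "rat_real.independent (insert 1 B)" and e: "e > 0"
  obtains k :: int where "\<And>b. b \<in> B \<Longrightarrow> near_integer (of_int k * b - \<tau> b) e"
proof -
  obtain \<theta>0 where bij: "bij_betw \<theta>0 {0..<card B} B" using ex_bij_betw_nat_finite B by blast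
  let ?n = "card B"
  \<comment> \<open>\<open>Kronecker_thm_2\<close> expects the frequency 1 at the last index
    \<open>?n\<close>; the elements of \<open>B\<close> take the indices below it.\<close>
  define \<theta> where "\<theta> i = (if i < ?n then \<theta>0 i else 1)" for i
  have im: "\<theta> ` {..<?n} = B" and inj: "inj_on \<theta> {..<?n}"
    using bij by (auto simp: bij_betw_def \<theta>_def lessThan_atLeast0 inj_on_def)
  have one: "\<theta> ?n = 1" by (simp add: \<theta>_def)
  have im': "\<theta> ` {..?n} = insert 1 B"
    using im one by (simp add: lessThan_Suc_atMost[symmetric] lessThan_Suc)
  have inj': "inj_on \<theta> {..?n}"
    using inj im one B(2) by (simp add: lessThan_Suc_atMost[symmetric] lessThan_Suc)
  have "module.independent (\<lambda>r x. real_of_int r * x) (\<theta> ` {..?n})"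
    unfolding im' by (rule int_independent_if_rat_independent[OF B(3)])
  then obtain k m where km: "\<And>i. i < ?n \<Longrightarrow> \<bar>of_int k * \<theta> i - of_int (m i) - \<tau> (\<theta> i)\<bar> < e"
    using Kronecker_thm_2[OF _ inj' one e, of "\<lambda>i. \<tau> (\<theta> i)"] by blast
  show ?thesis
  proof (rule that[of k])
    fix b assume "b \<in> B"
    then obtain i where "i < ?n" "b = \<theta> i" using im by auto
    then show "near_integer (of_int k * b - \<tau> b) e"
      using km[of i] unfolding near_integer_def by (intro exI[of _ "m i"]) (simp add: algebra_simps)
  qed
qed

lemma common_denominator:
  fixes X :: "rat set"
  assumes "finite X"
  shows "\<exists>q::int. q > 0 \<and> (\<forall>x\<in>X. of_int q * x \<in> \<int>)"
  using assms
proof (induction X rule: finite_induct)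
  case (insert x X)
  then obtain q :: int where q: "q > 0" "\<And>x. x \<in> X \<Longrightarrow> of_int q * x \<in> \<int>" by blast
  obtain a b :: int where ab: "x = Fract a b" "b > 0" using Rat_cases by blast
  have "of_int (q * b) * x = of_int (q * a)" using ab by (simp add: Fract_of_int_quotient)
  then have "of_int (q * b) * x \<in> \<int>" by (metis Ints_of_int)
  moreover have "of_int (q * b) * y \<in> \<int>" if "y \<in> X" for y
  proof -
    have "of_int (q * b) * y = of_int b * (of_int q * y)" by simp
    then show ?thesis using q(2)[OF that] Ints_mult[OF Ints_of_int] by metis
  qed
  ultimately show ?case using q(1) ab(2) by (intro exI[of _ "q * b"]) auto
qed (auto intro: exI[of _ 1])

text \<open>By the exchange property, all but \<open>r\<close> of the \<open>\<gamma> i\<close> extend a basis of the rational span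
  of \<open>1\<close> and the \<open>\<alpha> j\<close>; Kronecker's theorem makes these independent of the \<open>\<alpha> j\<close>.\<close>

lemma joint_approximation:
  fixes \<alpha> \<gamma> :: "nat \<Rightarrow> real" and n0 :: int
  assumes inj: "inj_on \<gamma> {..<N}" and one: "1 \<notin> \<gamma> ` {..<N}"
    and ind: "rat_real.independent (insert 1 (\<gamma> ` {..<N}))" and e: "e > 0" and \<eta>: "\<eta> > 0"
  obtains n :: int where "\<And>j. j < r \<Longrightarrow> near_integer (of_int (n - n0) * \<alpha> j) \<eta>"
    "card {i. i < N \<and> \<not> near_integer (of_int n * \<gamma> i - y) e} \<le> r"
proof -
  let ?V = "insert 1 (\<alpha> ` {..<r})" and ?\<Gamma> = "\<gamma> ` {..<N}"
  obtain B1 where B1: "{1} \<subseteq> B1" "B1 \<subseteq> ?V" "rat_real.independent B1" "?V \<subseteq> rat_real.span B1"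
    using rat_real.maximal_independent_subset_extend[of "{1}" ?V]
    by (auto simp: rat_real.independent_insert)
  obtain B2 where B2: "B1 \<subseteq> B2" "B2 \<subseteq> B1 \<union> ?\<Gamma>" "rat_real.independent B2" "B1 \<union> ?\<Gamma> \<subseteq> rat_real.span B2"
    using rat_real.maximal_independent_subset_extend[of B1 "B1 \<union> ?\<Gamma>"] B1(3) by auto
  have fin1: "finite B1" using B1(2) finite_subset by blast
  then have fin2: "finite B2" using B2(2) finite_subset by blast
  have card1: "card B1 \<le> Suc r"
  proof -
    have "card B1 \<le> card ?V" using B1(2) by (intro card_mono) auto
    also have "\<dots> \<le> Suc (card (\<alpha> ` {..<r}))" by (rule card_insert_le_m1[of "Suc _", simplified]) simp
    also have "\<dots> \<le> Suc r" using card_image_le[of "{..<r}" \<alpha>] by simp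
    finally show ?thesis .
  qed
  \<comment> \<open>The \<open>N + 1\<close> independent numbers 1 and \<open>\<gamma> i\<close> lie
    in the span of \<open>B2\<close>, which therefore has at least \<open>N + 1\<close> elements,
    while \<open>B1\<close> has at most \<open>r + 1\<close>.\<close>
  have "card (insert 1 ?\<Gamma>) = Suc N" using inj one by (simp add: card_image)
  moreover have "card (insert 1 ?\<Gamma>) \<le> card B2"
    using rat_real.independent_span_bound[OF fin2 ind] B2(4) B1(1) by auto
  ultimately have "card (B2 - B1) \<ge> N - r"
    using card1 fin1 B2(1) by (simp add: card_Diff_subset)
  moreover have "card (B2 - B1) = card {i. i < N \<and> \<gamma> i \<in> B2 - B1}"
  proof -
    have "\<gamma> ` {i. i < N \<and> \<gamma> i \<in> B2 - B1} = B2 - B1" using B2(2) by auto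
    moreover have "inj_on \<gamma> {i. i < N \<and> \<gamma> i \<in> B2 - B1}" using inj by (auto simp: inj_on_def)
    ultimately show ?thesis by (metis card_image)
  qed
  moreover have "card {i. i < N \<and> \<gamma> i \<in> B2 - B1} + card {i. i < N \<and> \<gamma> i \<notin> B2 - B1} = N"
  proof -
    have "card ({i. i < N \<and> \<gamma> i \<in> B2 - B1} \<union> {i. i < N \<and> \<gamma> i \<notin> B2 - B1})
        = card {i. i < N \<and> \<gamma> i \<in> B2 - B1} + card {i. i < N \<and> \<gamma> i \<notin> B2 - B1}"
      by (rule card_Un_disjoint) auto
    moreover have "{i. i < N \<and> \<gamma> i \<in> B2 - B1} \<union> {i. i < N \<and> \<gamma> i \<notin> B2 - B1} = {..<N}" by auto
    ultimately show ?thesis by simp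
  qed
  ultimately have few: "card {i. i < N \<and> \<gamma> i \<notin> B2 - B1} \<le> r" by linarith

  have "\<forall>j\<in>{..<r}. \<exists>u. \<alpha> j = (\<Sum>b\<in>B1. of_rat (u b) * b)"
    using B1(4) unfolding rat_real.span_finite[OF fin1] by auto
  then obtain u where u: "\<And>j. j < r \<Longrightarrow> \<alpha> j = (\<Sum>b\<in>B1. of_rat (u j b) * b)"
    by (metis lessThan_iff)
  \<comment> \<open>Once \<open>q\<close> clears the denominators of the coordinates,
    \<open>q * k * \<alpha> j\<close> is an integer combination of the \<open>k * b\<close> with
    \<open>b \<in> B1\<close>, hence near an integer as soon as these are.\<close>
  obtain q :: int where q: "q > 0" and qint: "\<And>j b. j < r \<Longrightarrow> b \<in> B1 \<Longrightarrow> of_int q * u j b \<in> \<int>"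
    using common_denominator[of "(\<lambda>(j, b). u j b) ` ({..<r} \<times> B1)"] fin1 by fastforce
  define c where "c j b = \<lfloor>of_int q * u j b\<rfloor>" for j b
  have c: "of_int q * u j b = of_int (c j b)" if "j < r" "b \<in> B1" for j b
    using qint[OF that] by (simp add: c_def)
  have cr: "real_of_int q * of_rat (u j b) = of_int (c j b)" if "j < r" "b \<in> B1" for j b
    using c[OF that] by (metis of_rat_mult of_rat_of_int_eq)
  define C where "C = (\<Sum>j<r. \<Sum>b\<in>B1. \<bar>real_of_int (c j b)\<bar>)"
  have C0: "C \<ge> 0" unfolding C_def by (intro sum_nonneg) auto
  have C: "(\<Sum>b\<in>B1. \<bar>real_of_int (c j b)\<bar>) \<le> C" if "j < r" for j
    unfolding C_def using that
    by (intro member_le_sum[where f = "\<lambda>j. \<Sum>b\<in>B1. \<bar>real_of_int (c j b)\<bar>"] sum_nonneg) auto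
  \<comment> \<open>The first bound survives multiplication by \<open>q\<close>, the second survives
    coefficients of total size at most \<open>C\<close>; \<open>C + 1\<close> keeps the final
    estimate strict.\<close>
  define \<kappa> where "\<kappa> = min (e / of_int q) (\<eta> / (C + 1))"
  have \<kappa>: "\<kappa> > 0" using e \<eta> q C0 by (simp add: \<kappa>_def)
  \<comment> \<open>The solution is sought as \<open>n0 + q * k\<close>. On \<open>B1\<close> the
    multiples \<open>k * b\<close> should be near integers; on the new basis elements the target
    makes \<open>(n0 + q * k) * b\<close> close to \<open>y\<close> modulo 1.\<close>
  define \<tau> where "\<tau> b = (if b \<in> B1 then 0 else (y - of_int n0 * b) / of_int q)" for b
  have "insert 1 (B2 - {1}) = B2" using B1(1) B2(1) by auto
  then obtain k :: int where k: "\<And>b. b \<in> B2 - {1} \<Longrightarrow> near_integer (of_int k * b - \<tau> b) \<kappa>"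
    using Kronecker_set[of "B2 - {1}" \<kappa> \<tau>] fin2 B2(3) \<kappa> by auto
  show ?thesis
  proof (rule that[of "n0 + q * k"])
    fix j assume j: "j < r"
    have "\<exists>h::int. \<bar>of_int k * b - of_int h\<bar> \<le> \<kappa>" if "b \<in> B1" for b
    proof (cases "b = 1")
      case True
      then show ?thesis using \<kappa> by (intro exI[of _ k]) simp
    next
      case False
      then show ?thesis
        using k[of b] that B2(1) by (auto simp: near_integer_def \<tau>_def intro: less_imp_le)
    qed
    then obtain h :: "real \<Rightarrow> int" where h: "\<And>b. b \<in> B1 \<Longrightarrow> \<bar>of_int k * b - of_int (h b)\<bar> \<le> \<kappa>"
      by metis
    have "of_int (n0 + q * k - n0) * \<alpha> j = of_int k * (\<Sum>b\<in>B1. of_int q * of_rat (u j b) * b)"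
      using u[OF j] by (simp add: sum_distrib_left mult_ac)
    also have "\<dots> = (\<Sum>b\<in>B1. of_int (c j b) * (of_int k * b))"
      using cr[OF j] by (simp add: sum_distrib_left mult_ac)
    finally have eq: "of_int (n0 + q * k - n0) * \<alpha> j = (\<Sum>b\<in>B1. of_int (c j b) * (of_int k * b))" .
    have "\<bar>of_int (n0 + q * k - n0) * \<alpha> j - of_int (\<Sum>b\<in>B1. c j b * h b)\<bar>
        = \<bar>\<Sum>b\<in>B1. of_int (c j b) * (of_int k * b - of_int (h b))\<bar>"
      unfolding eq by (simp add: right_diff_distrib sum_subtractf)
    also have "\<dots> \<le> (\<Sum>b\<in>B1. \<bar>of_int (c j b)\<bar> * \<kappa>)"
      by (rule order_trans[OF sum_abs], rule sum_mono) (simp add: abs_mult h mult_left_mono)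
    also have "\<dots> \<le> C * \<kappa>"
      using C[OF j] \<kappa> by (simp flip: sum_distrib_right)
    also have "\<dots> \<le> C * (\<eta> / (C + 1))" using C0 by (intro mult_left_mono) (auto simp: \<kappa>_def)
    also have "\<dots> < \<eta>" using C0 \<eta> by (simp add: field_simps)
    finally show "near_integer (of_int (n0 + q * k - n0) * \<alpha> j) \<eta>"
      unfolding near_integer_def by blast
  next
    have good: "near_integer (of_int (n0 + q * k) * \<gamma> i - y) e" if "\<gamma> i \<in> B2 - B1" for i
    proof -
      have \<tau>: "\<tau> (\<gamma> i) = (y - of_int n0 * \<gamma> i) / of_int q" using that by (simp add: \<tau>_def)
      have "\<gamma> i \<in> B2 - {1}" using that B1(1) by auto
      then obtain h :: int where h: "\<bar>of_int k * \<gamma> i - (y - of_int n0 * \<gamma> i) / of_int q - of_int h\<bar> < \<kappa>"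
        using k[of "\<gamma> i"] \<tau> by (auto simp: near_integer_def)
      have "of_int (n0 + q * k) * \<gamma> i - y - of_int (q * h)
          = of_int q * (of_int k * \<gamma> i - (y - of_int n0 * \<gamma> i) / of_int q - of_int h)"
        using q by (simp add: field_simps)
      then have "\<bar>of_int (n0 + q * k) * \<gamma> i - y - of_int (q * h)\<bar>
          = of_int q * \<bar>of_int k * \<gamma> i - (y - of_int n0 * \<gamma> i) / of_int q - of_int h\<bar>"
        using q by (simp only: abs_mult)
      also have "\<dots> < of_int q * \<kappa>" using h q by (intro mult_strict_left_mono) auto
      also have "\<dots> \<le> of_int q * (e / of_int q)" using q by (intro mult_left_mono) (auto simp: \<kappa>_def)
      also have "\<dots> = e" using q by simp
      finally show ?thesis unfolding near_integer_def by blast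
    qed
    have "card {i. i < N \<and> \<not> near_integer (of_int (n0 + q * k) * \<gamma> i - y) e}
        \<le> card {i. i < N \<and> \<gamma> i \<notin> B2 - B1}"
      using good by (intro card_mono) auto
    then show "card {i. i < N \<and> \<not> near_integer (of_int (n0 + q * k) * \<gamma> i - y) e} \<le> r"
      using few by linarith
  qed
qed

section \<open>The Bohr topology\<close>

lemma open_near_integer: "open {x. near_integer x e}"
proof -
  have "{x. near_integer x e} = (\<Union>h::int. {of_int h - e<..<of_int h + e})"
    by (auto simp: near_integer_def abs_less_iff algebra_simps)
  then show ?thesis by auto
qed

lemma near_integer_add_int: "near_integer (x + of_int k) e \<longleftrightarrow> near_integer x e"
proof -
  have "near_integer (x + of_int k) e" if near: "near_integer x e" for x k
  proof -
    obtain h :: int where "\<bar>x - of_int h\<bar> < e" using near by (auto simp: near_integer_def)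
    then show ?thesis unfolding near_integer_def by (intro exI[of _ "h + k"]) simp
  qed
  from this[of x k] this[of "x + of_int k" "- k"] show ?thesis by auto
qed

lemma abs_circle_eq_iff: "abs_circle x = abs_circle y \<longleftrightarrow> x - y \<in> \<int>"
  by (simp add: circle.abs_eq_iff)

lemma additive_abs_circle_mult: "Modules.additive (\<lambda>n::int. abs_circle (of_int n * \<theta>))"
  by (simp add: Modules.additive_def plus_circle.abs_eq distrib_right)

text \<open>A homomorphism on the integers is determined by its value at 1; any real lift of that
  value serves as \<open>\<theta>\<close>.\<close>

lemma additive_circle_form:
  fixes \<phi> :: "int \<Rightarrow> circle"
  assumes "Modules.additive \<phi>"
  shows "\<exists>\<theta>. \<forall>n. \<phi> n = abs_circle (of_int n * \<theta>)"
proof -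
  interpret additive \<phi> by (rule assms)
  obtain \<theta> where \<theta>: "\<phi> 1 = abs_circle \<theta>" using Quotient_abs_rep[OF Quotient_circle, of "\<phi> 1"] by metis
  have "\<phi> n = abs_circle (of_int n * \<theta>)" for n
  proof (induction n rule: int_induct[where k = 0])
    case base
    then show ?case by (simp add: zero zero_circle_def)
  next
    case (step1 i)
    then show ?case by (simp add: add \<theta> plus_circle.abs_eq distrib_right)
  next
    case (step2 i)
    then show ?case by (simp add: diff \<theta> minus_circle.abs_eq left_diff_distrib)
  qed
  then show ?thesis by blast
qed

text \<open>The preimage of \<open>?U\<close> under the homomorphism with frequency
  \<open>\<theta>\<close>. \<open>?U\<close> is open because its lift to the reals is already
  invariant under integer translations.\<close>

lemma openin_bohr_near: "openin bohr_topology {n. near_integer (of_int n * \<theta> - y) e}"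
proof -
  let ?U = "abs_circle ` {x. near_integer (x - y) e}"
  have vim: "abs_circle -` ?U = {x. near_integer (x - y) e}"
  proof (intro equalityI subsetI)
    fix x assume "x \<in> abs_circle -` ?U"
    then obtain z where z: "near_integer (z - y) e" "x - z \<in> \<int>" by (auto simp: abs_circle_eq_iff)
    then obtain k where k: "x - z = of_int k" by (auto elim: Ints_cases)
    have "x - y = (z - y) + of_int k" using k by simp
    then show "x \<in> {x. near_integer (x - y) e}"
      using z(1) by (simp only: mem_Collect_eq near_integer_add_int)
  qed auto
  have "{x. near_integer (x - y) e} = (\<lambda>x. x - y) -` {x. near_integer x e}" by auto
  also have "open \<dots>" by (rule open_vimage[OF open_near_integer]) (intro continuous_intros)
  finally have "open ?U" unfolding open_circle_def vim .
  moreover have "{n. near_integer (of_int n * \<theta> - y) e} = (\<lambda>n. abs_circle (of_int n * \<theta>)) -` ?U"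
    using vim by (auto simp: vimage_def set_eq_iff)
  ultimately show ?thesis
    unfolding bohr_topology_def using additive_abs_circle_mult[of \<theta>]
    by (intro topology_generated_by_Basis) blast
qed

lemma topspace_bohr: "topspace bohr_topology = UNIV"
proof -
  have "openin bohr_topology UNIV"
    using openin_bohr_near[of 0 0 1] by (simp add: near_integer_def exI[of _ 0])
  then show ?thesis using openin_subset by blast
qed

text \<open>The integer \<open>n\<close> certifies that a finite intersection of Bohr open sets is
  nonempty; density then yields a point of \<open>S\<close> in it.\<close>

lemma bohr_dense_meets:
  assumes "bohr_dense S" and "finite X"
    and near: "\<And>\<theta> y e. (\<theta>, y, e) \<in> X \<Longrightarrow> near_integer (of_int n * \<theta> - y) e"
  obtains s where "s \<in> S" "\<And>\<theta> y e. (\<theta>, y, e) \<in> X \<Longrightarrow> near_integer (of_int s * \<theta> - y) e"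
proof -
  let ?W = "\<Inter>(\<theta>, y, e)\<in>X. {n. near_integer (of_int n * \<theta> - y) e}"
  have "openin bohr_topology (?W \<inter> topspace bohr_topology)"
    using openin_bohr_near by (intro openin_INT[OF \<open>finite X\<close>]) auto
  then have "openin bohr_topology ?W" by (simp only: topspace_bohr Int_UNIV_right)
  moreover have "n \<in> ?W" using near by auto
  moreover have "n \<in> bohr_topology closure_of S" using assms(1) by (simp add: bohr_dense_def)
  ultimately obtain s where "s \<in> S" "s \<in> ?W" by (meson in_closure_of)
  then show ?thesis using that by blast
qed

text \<open>Induction over the generation of the topology: a subbasic set needs one frequency, and
  an intersection joins the frequency sets and takes the smaller radius.\<close>

lemma bohr_open_contains_near:
  assumes "openin bohr_topology V" "n \<in> V"
  shows "\<exists>\<Theta> e. finite \<Theta> \<and> e > 0 \<and> (\<forall>k. (\<forall>\<theta>\<in>\<Theta>. near_integer (of_int (k - n) * \<theta>) e) \<longrightarrow> k \<in> V)"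
proof -
  let ?P = "\<lambda>V n \<Theta> e. finite \<Theta> \<and> e > 0 \<and> (\<forall>k. (\<forall>\<theta>\<in>\<Theta>. near_integer (of_int (k - n) * \<theta>) e) \<longrightarrow> k \<in> V)"
  have mono: "near_integer x e" if "near_integer x d" "d \<le> e" for x d e
    using that unfolding near_integer_def by (meson less_le_trans)
  have "generate_topology_on {\<phi> -` U | \<phi> U. Modules.additive (\<phi> :: int \<Rightarrow> circle) \<and> open U} V"
    using assms(1) unfolding bohr_topology_def by (simp add: openin_topology_generated_by_iff)
  then show ?thesis
    using assms(2)
  proof (induction V arbitrary: n rule: generate_topology_on.induct)
    case (Int a b)
    obtain \<Theta> d where a: "?P a n \<Theta> d" using Int.IH(1) Int.prems by blast
    obtain \<Theta>' e where b: "?P b n \<Theta>' e" using Int.IH(2) Int.prems by blast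
    have "k \<in> a \<inter> b" if k: "\<forall>\<theta>\<in>\<Theta> \<union> \<Theta>'. near_integer (of_int (k - n) * \<theta>) (min d e)" for k
    proof -
      have "\<forall>\<theta>\<in>\<Theta>. near_integer (of_int (k - n) * \<theta>) d"
        using k by (blast intro: mono[OF _ min.cobounded1])
      moreover have "\<forall>\<theta>\<in>\<Theta>'. near_integer (of_int (k - n) * \<theta>) e"
        using k by (blast intro: mono[OF _ min.cobounded2])
      ultimately show ?thesis using a b by blast
    qed
    then show ?case using a b by (intro exI[of _ "\<Theta> \<union> \<Theta>'"] exI[of _ "min d e"]) auto
  next
    case (UN K)
    then obtain V where V: "V \<in> K" "n \<in> V" by blast
    obtain \<Theta> e where "?P V n \<Theta> e" using UN.IH[OF V] by blast
    then show ?case using V(1) by (intro exI[of _ \<Theta>] exI[of _ e]) blast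
  next
    case (Basis V)
    then obtain \<phi> :: "int \<Rightarrow> circle" and U where \<phi>: "V = \<phi> -` U" "Modules.additive \<phi>" "open U" by blast
    obtain \<theta> where \<theta>: "\<forall>n. \<phi> n = abs_circle (of_int n * \<theta>)" using additive_circle_form[OF \<phi>(2)] ..
    have "open (abs_circle -` U)" using \<phi>(3) by (simp add: open_circle_def)
    moreover have "of_int n * \<theta> \<in> abs_circle -` U" using Basis.prems \<phi>(1) \<theta> by simp
    ultimately obtain e where e: "e > 0" "\<And>x. \<bar>x - of_int n * \<theta>\<bar> < e \<Longrightarrow> x \<in> abs_circle -` U"
      by (auto simp: open_dist dist_real_def)
    have "k \<in> V" if near: "near_integer (of_int (k - n) * \<theta>) e" for k
    proof -
      obtain h :: int where h: "\<bar>of_int (k - n) * \<theta> - of_int h\<bar> < e"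
        using near by (auto simp: near_integer_def)
      have "abs_circle (of_int k * \<theta> - of_int h) \<in> U"
        using e(2)[of "of_int k * \<theta> - of_int h"] h by (simp add: algebra_simps)
      moreover have "abs_circle (of_int k * \<theta> - of_int h) = \<phi> k"
        by (simp add: \<theta> abs_circle_eq_iff)
      ultimately show ?thesis using \<phi>(1) by simp
    qed
    then show ?case using e(1) by (intro exI[of _ "{\<theta>}"] exI[of _ e]) auto
  qed simp
qed

text \<open>The finitely many frequencies of a neighbourhood are listed as the first
  \<open>r\<close> values of \<open>\<alpha>\<close>, the form in which the compactness argument
  treats them.\<close>

lemma bohr_denseI:
  assumes "\<And>n e (\<alpha> :: nat \<Rightarrow> real) r. e > 0 \<Longrightarrow> \<exists>s\<in>S. \<forall>j<r. near_integer (of_int (s - n) * \<alpha> j) e"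
  shows "bohr_dense S"
proof -
  have "n \<in> bohr_topology closure_of S" for n
    unfolding in_closure_of topspace_bohr
  proof (intro conjI allI impI UNIV_I)
    fix V assume "n \<in> V \<and> openin bohr_topology V"
    then obtain \<Theta> e where \<Theta>: "finite \<Theta>" "e > 0"
      and V: "\<And>k. (\<forall>\<theta>\<in>\<Theta>. near_integer (of_int (k - n) * \<theta>) e) \<Longrightarrow> k \<in> V"
      using bohr_open_contains_near by metis
    obtain \<alpha> where "bij_betw \<alpha> {0..<card \<Theta>} \<Theta>" using ex_bij_betw_nat_finite[OF \<Theta>(1)] by blast
    then have \<alpha>: "\<Theta> = \<alpha> ` {0..<card \<Theta>}" by (simp add: bij_betw_def)
    obtain s where "s \<in> S" and s: "\<forall>j<card \<Theta>. near_integer (of_int (s - n) * \<alpha> j) e"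
      using assms[OF \<Theta>(2)] by blast
    have "\<forall>\<theta>\<in>\<Theta>. near_integer (of_int (s - n) * \<theta>) e"
      using s by (subst \<alpha>) auto
    then show "\<exists>y. y \<in> S \<and> y \<in> V" using V \<open>s \<in> S\<close> by blast
  qed
  then show ?thesis unfolding bohr_dense_def by blast
qed

section \<open>Enlarging the avoided set\<close>

lemma compact_cube: "compact (PiE UNIV (\<lambda>_. {0..1}) :: ('a \<Rightarrow> real) set)"
proof -
  have "compactin (product_topology (\<lambda>_. euclidean) UNIV) (PiE UNIV (\<lambda>_::'a. {0..1::real}))"
    by (simp add: compactin_PiE)
  then show ?thesis by (simp add: euclidean_product_topology)
qed

text \<open>Each \<open>s\<close> serves an open set of \<open>\<alpha>\<close>, and finitely many
  of these cover the compact cube. Every \<open>\<alpha>\<close> reduces to the cube through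
  fractional parts, which changes integer multiples by integers only.\<close>

lemma finite_bohr_hitting_set:
  fixes G :: "int set"
  assumes meets: "\<And>\<alpha> :: nat \<Rightarrow> real. \<exists>s\<in>G. \<forall>j<r. near_integer (of_int (s - n) * \<alpha> j) e"
  obtains D where "finite D" "D \<subseteq> G"
    "\<And>\<alpha> :: nat \<Rightarrow> real. \<exists>s\<in>D. \<forall>j<r. near_integer (of_int (s - n) * \<alpha> j) e"
proof -
  let ?C = "PiE UNIV (\<lambda>_. {0..1}) :: (nat \<Rightarrow> real) set"
  define O' where "O' s = {\<alpha> :: nat \<Rightarrow> real. \<forall>j\<in>{..<r}. near_integer (of_int (s - n) * \<alpha> j) e}" for s
  have opn: "open (O' s)" for s
  proof -
    have "O' s = (\<Inter>j\<in>{..<r}. (\<lambda>\<alpha>. of_int (s - n) * \<alpha> j) -` {x. near_integer x e})"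
      by (auto simp: O'_def)
    also have "open \<dots>"
      by (intro open_INT ballI finite_lessThan open_vimage[OF open_near_integer]
          continuous_on_mult continuous_on_const continuous_on_product_coordinates)
    finally show ?thesis .
  qed
  have cover: "?C \<subseteq> (\<Union>s\<in>G. O' s)" using meets by (fastforce simp: O'_def)
  obtain D where D: "D \<subseteq> G" "finite D" "?C \<subseteq> (\<Union>s\<in>D. O' s)"
    by (rule compactE_image[OF compact_cube opn cover])
  show ?thesis
  proof (rule that[OF D(2,1)])
    fix \<alpha> :: "nat \<Rightarrow> real"
    have "(\<lambda>j. frac (\<alpha> j)) \<in> ?C" by (auto simp: less_imp_le[OF frac_lt_1])
    then obtain s where "s \<in> D" and "(\<lambda>j. frac (\<alpha> j)) \<in> O' s" using D(3) by blast
    then have s: "near_integer (of_int (s - n) * frac (\<alpha> j)) e" if "j < r" for j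
      using that by (simp add: O'_def)
    have "near_integer (of_int (s - n) * \<alpha> j) e" if "j < r" for j
    proof -
      have "of_int (s - n) * \<alpha> j = of_int (s - n) * frac (\<alpha> j) + of_int ((s - n) * \<lfloor>\<alpha> j\<rfloor>)"
        by (simp add: frac_def algebra_simps)
      then show ?thesis using s[OF that] by (simp only: near_integer_add_int)
    qed
    then show "\<exists>s\<in>D. \<forall>j<r. near_integer (of_int (s - n) * \<alpha> j) e" using \<open>s \<in> D\<close> by blast
  qed
qed

text \<open>Finitely many open conditions on the \<open>\<gamma> i\<close> persist under small
  perturbations, so rationals with denominator \<open>2 * k + 1\<close> close to the
  \<open>\<gamma> i\<close> satisfy them for large \<open>k\<close>.\<close>

lemma odd_denominator_approximation:
  fixes \<gamma> :: "nat \<Rightarrow> real" and c :: "int \<Rightarrow> real"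
  assumes "finite F"
  obtains Q :: int and g :: "nat \<Rightarrow> int" where "Q > 0" "odd Q"
    "\<And>s i. s \<in> F \<Longrightarrow> i < N \<Longrightarrow> near_integer (of_int s * \<gamma> i - c s) e \<Longrightarrow>
      near_integer (of_int s * (of_int (g i) / of_int Q) - c s) e"
proof -
  define Q where "Q k = 2 * int k + 1" for k
  define h where "h k i = of_int \<lfloor>of_int (Q k) * \<gamma> i\<rfloor> / real_of_int (Q k)" for k i
  have "(\<lambda>k. h k i) \<longlonglongrightarrow> \<gamma> i" for i
  proof -
    have "(\<lambda>k. h k i - \<gamma> i) \<longlonglongrightarrow> 0"
    proof (rule Lim_null_comparison[OF _ LIMSEQ_inverse_real_of_nat], intro always_eventually allI)
      fix k
      have Q: "real_of_int (Q k) > 0" by (simp add: Q_def)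
      have "\<bar>of_int \<lfloor>of_int (Q k) * \<gamma> i\<rfloor> - of_int (Q k) * \<gamma> i\<bar> \<le> 1" by linarith
      moreover have "h k i - \<gamma> i = (of_int \<lfloor>of_int (Q k) * \<gamma> i\<rfloor> - of_int (Q k) * \<gamma> i) / of_int (Q k)"
        using Q by (simp add: h_def diff_divide_distrib)
      ultimately have "norm (h k i - \<gamma> i) \<le> 1 / of_int (Q k)"
        using Q by (simp add: divide_right_mono)
      also have "\<dots> \<le> inverse (real (Suc k))"
        by (simp add: Q_def divide_simps)
      finally show "norm (h k i - \<gamma> i) \<le> inverse (real (Suc k))" .
    qed
    then show ?thesis by (rule LIM_zero_cancel)
  qed
  then have lim: "(\<lambda>k. of_int s * h k i - c s) \<longlonglongrightarrow> of_int s * \<gamma> i - c s" for s i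
    by (intro tendsto_intros)
  have "\<forall>\<^sub>F k in sequentially. near_integer (of_int s * \<gamma> i - c s) e \<longrightarrow> near_integer (of_int s * h k i - c s) e" for s i
    using topological_tendstoD[OF lim open_near_integer[of e], of s i]
    by (cases "near_integer (of_int s * \<gamma> i - c s) e") auto
  then have "\<forall>\<^sub>F k in sequentially. \<forall>s\<in>F. \<forall>i\<in>{..<N}. near_integer (of_int s * \<gamma> i - c s) e \<longrightarrow> near_integer (of_int s * h k i - c s) e"
    using assms by (intro eventually_ball_finite ballI) auto
  then obtain k where k: "\<forall>s\<in>F. \<forall>i\<in>{..<N}. near_integer (of_int s * \<gamma> i - c s) e \<longrightarrow> near_integer (of_int s * h k i - c s) e"
    by (auto simp: eventually_sequentially)
  show ?thesis
    by (rule that[of "Q k" "\<lambda>i. \<lfloor>of_int (Q k) * \<gamma> i\<rfloor>"]) (use k in \<open>auto simp: Q_def h_def\<close>)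
qed

text \<open>The induction step. The strict density inequality of the old witness pays for the
  ballots that are not decisive.\<close>

lemma extend_modular_witness:
  assumes S: "bohr_dense S" and \<delta>: "\<delta> \<ge> 0" and F: "finite F" "1 \<in> F" "modular_witness \<delta> F"
    and d: "d > 0"
  obtains T where "finite T" "T \<subseteq> S" "modular_witness \<delta> (F \<union> T)"
    "\<And>n (\<alpha> :: nat \<Rightarrow> real). \<bar>n\<bar> \<le> b \<Longrightarrow> \<exists>s\<in>T. \<forall>j<r. near_integer (of_int (s - n) * \<alpha> j) d"
proof -
  obtain m A where m: "m > 0" "odd m" and perA: "\<And>n. n + m \<in> A \<longleftrightarrow> n \<in> A"
    and densA: "\<delta> * of_int m < real (card (A \<inter> {0..<m}))"
    and A: "\<And>n s. n \<in> A \<Longrightarrow> s \<in> F \<Longrightarrow> n + s \<notin> A"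
    using F(3) unfolding modular_witness_def by blast
  obtain B where perB: "\<And>n. n + 2 * m \<in> B \<longleftrightarrow> n \<in> B"
    and cardB: "card (B \<inter> {0..<2 * m}) = 2 * card (A \<inter> {0..<m})"
    and Bm: "\<And>n. n \<in> B \<Longrightarrow> n + m \<notin> B"
    and Bs: "\<And>n s. (\<And>a. a \<in> A \<Longrightarrow> a + s \<notin> A) \<Longrightarrow> n \<in> B \<Longrightarrow> n + 2 * s \<notin> B"
    using double_periodic_set[OF m perA A[OF _ F(2)]] by metis
  define M where "M = 2 * m"
  have M: "M \<ge> 2" using m by (simp add: M_def)
  define \<beta> where "\<beta> = real (card (B \<inter> {0..<M}))"
  have \<beta>: "\<delta> * of_int M < \<beta>" using densA cardB by (simp add: \<beta>_def M_def)
  have "0 \<le> \<delta> * of_int M" using \<delta> M by simp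
  then have \<beta>0: "\<beta> > 0" using \<beta> by linarith
  \<comment> \<open>With this choice \<open>\<beta> * (1 - \<eta>)\<close> is the midpoint of
    \<open>\<delta> * M\<close> and \<open>\<beta>\<close>.\<close>
  define \<eta> where "\<eta> = (\<beta> - \<delta> * of_int M) / (2 * \<beta>)"
  have \<eta>: "\<eta> > 0" using \<beta> \<beta>0 by (simp add: \<eta>_def)
  have \<beta>\<eta>: "\<delta> * of_int M < \<beta> * (1 - \<eta>)" using \<beta> \<beta>0 by (simp add: \<eta>_def field_simps)
  obtain N and L :: int where L: "L > 0"
    and dec: "(1 - \<eta>) * of_int (M * L) ^ N \<le> real (card (decisive M L r N))"
    using exists_decisive[OF M \<eta>] by blast
  have K: "real_of_int (M * L) ^ N > 0" using M L by simp
  have "\<delta> * (of_int M * of_int (M * L) ^ N) < \<beta> * (1 - \<eta>) * of_int (M * L) ^ N"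
    using mult_strict_right_mono[OF \<beta>\<eta> K] by (simp only: mult.assoc)
  also have "\<dots> \<le> \<beta> * real (card (decisive M L r N))"
    using mult_left_mono[OF dec, of \<beta>] \<beta>0 by (simp only: mult.assoc less_imp_le)
  finally have dens: "\<delta> * (of_int M * of_int (M * L) ^ N)
      < real (card (B \<inter> {0..<M})) * real (card (decisive M L r N))"
    unfolding \<beta>_def .
  define e where "e = 1 / real_of_int (M * L)"
  have e: "e > 0" using M L by (simp add: e_def)
  \<comment> \<open>\<open>R\<close> exceeds every \<open>\<bar>s\<bar>\<close> with
    \<open>s \<in> F\<close>, so frequencies within \<open>e / R\<close> of \<open>1 / m\<close>
    keep \<open>s * \<gamma> i\<close> within \<open>e\<close> of \<open>s / m\<close>; the added 1
    makes \<open>R\<close> positive.\<close>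
  define R where "R = (\<Sum>s\<in>F. \<bar>real_of_int s\<bar>) + 1"
  have R: "R > 0" unfolding R_def by (intro add_nonneg_pos sum_nonneg) auto
  have RF: "\<bar>real_of_int s\<bar> < R" if "s \<in> F" for s
    using member_le_sum[OF that, of "\<lambda>s. \<bar>real_of_int s\<bar>"] F(1) by (simp add: R_def)
  obtain \<gamma> :: "nat \<Rightarrow> real" where \<gamma>: "\<And>i. i < N \<Longrightarrow> 1 / of_int m < \<gamma> i \<and> \<gamma> i < 1 / of_int m + e / R"
    and inj: "inj_on \<gamma> {..<N}" and one: "1 \<notin> \<gamma> ` {..<N}" and ind: "rat_real.independent (insert 1 (\<gamma> ` {..<N}))"
    using exists_rat_independent[of "1 / real_of_int m" "1 / of_int m + e / R" N] e R by auto
  have nearF: "near_integer (of_int s * \<gamma> i - of_int (2 * s) / of_int M) e" if "s \<in> F" "i < N" for s i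
  proof -
    have "of_int s * \<gamma> i - of_int (2 * s) / of_int M = of_int s * (\<gamma> i - 1 / of_int m)"
      using m by (simp add: M_def field_simps)
    moreover have "\<bar>real_of_int s\<bar> * \<bar>\<gamma> i - 1 / of_int m\<bar> \<le> R * \<bar>\<gamma> i - 1 / of_int m\<bar>"
      using RF[OF that(1)] by (intro mult_right_mono) auto
    moreover have "R * \<bar>\<gamma> i - 1 / of_int m\<bar> < R * (e / R)"
      using \<gamma>[OF that(2)] R by (intro mult_strict_left_mono) auto
    ultimately show ?thesis
      using R unfolding near_integer_def by (intro exI[of _ 0]) (simp add: abs_mult)
  qed
  define G where "G = {s \<in> S. card {i. i < N \<and> \<not> near_integer (of_int s * \<gamma> i - 1 / 2) e} \<le> r}"
  have G: "\<exists>s\<in>G. \<forall>j<r. near_integer (of_int (s - n) * \<alpha> j) d" for n and \<alpha> :: "nat \<Rightarrow> real"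
  proof -
    obtain k :: int where k: "\<And>j. j < r \<Longrightarrow> near_integer (of_int (k - n) * \<alpha> j) d"
      and kr: "card {i. i < N \<and> \<not> near_integer (of_int k * \<gamma> i - 1 / 2) e} \<le> r"
      using joint_approximation[OF inj one ind e d] by blast
    \<comment> \<open>Besides the conditions on the \<open>\<alpha> j\<close>, \<open>s\<close>
      inherits every condition on a \<open>\<gamma> i\<close> that \<open>k\<close> satisfies, so it
      has no more exceptional indices than \<open>k\<close>.\<close>
    define X where "X = (\<lambda>j. (\<alpha> j, of_int n * \<alpha> j, d)) ` {..<r} \<union>
      (\<lambda>i. (\<gamma> i, 1 / 2, e)) ` {i. i < N \<and> near_integer (of_int k * \<gamma> i - 1 / 2) e}"
    have "finite X" by (simp add: X_def)
    moreover have "near_integer (of_int k * \<theta> - y) t" if "(\<theta>, y, t) \<in> X" for \<theta> y t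
      using that k by (auto simp: X_def left_diff_distrib)
    ultimately obtain s where "s \<in> S" and s: "\<And>\<theta> y t. (\<theta>, y, t) \<in> X \<Longrightarrow> near_integer (of_int s * \<theta> - y) t"
      using bohr_dense_meets[OF S] by metis
    have "card {i. i < N \<and> \<not> near_integer (of_int s * \<gamma> i - 1 / 2) e}
        \<le> card {i. i < N \<and> \<not> near_integer (of_int k * \<gamma> i - 1 / 2) e}"
      using s by (intro card_mono) (auto simp: X_def)
    then have "s \<in> G" using \<open>s \<in> S\<close> kr by (simp add: G_def)
    moreover have "near_integer (of_int (s - n) * \<alpha> j) d" if "j < r" for j
      using s[of "\<alpha> j" "of_int n * \<alpha> j" d] that by (auto simp: X_def left_diff_distrib)
    ultimately show ?thesis by blast
  qed
  have "\<exists>D. finite D \<and> D \<subseteq> G \<and> (\<forall>\<alpha> :: nat \<Rightarrow> real. \<exists>s\<in>D. \<forall>j<r. near_integer (of_int (s - n) * \<alpha> j) d)" for n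
    using finite_bohr_hitting_set[of G r n d] G by metis
  then obtain D where D: "\<And>n. finite (D n)" "\<And>n. D n \<subseteq> G"
    and hit: "\<And>n (\<alpha> :: nat \<Rightarrow> real). \<exists>s\<in>D n. \<forall>j<r. near_integer (of_int (s - n) * \<alpha> j) d"
    by metis
  define T where "T = (\<Union>n\<in>{-b..b}. D n)"
  have T: "finite T" "T \<subseteq> G" using D by (auto simp: T_def)
  \<comment> \<open>Old elements rotate the candidates by \<open>2 * s\<close>, since
    \<open>\<gamma> i\<close> is close to \<open>2 / M\<close>; new ones rotate by \<open>m\<close>,
    half of \<open>M\<close>. An element of both \<open>F\<close> and \<open>T\<close> counts as
    old.\<close>
  define c where "c s = (if s \<in> F then 2 * s else m)" for s
  obtain Q :: int and g :: "nat \<Rightarrow> int" where Q: "Q > 0" "odd Q"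
    and g: "\<And>s i. s \<in> F \<union> T \<Longrightarrow> i < N \<Longrightarrow> near_integer (of_int s * \<gamma> i - of_int (c s) / of_int M) e \<Longrightarrow>
      near_integer (of_int s * (of_int (g i) / of_int Q) - of_int (c s) / of_int M) e"
    using odd_denominator_approximation[of "F \<union> T" N \<gamma> "\<lambda>s. of_int (c s) / of_int M" e] F(1) T(1)
    by auto
  have "modular_witness \<delta> (F \<union> T)"
  proof (rule modular_witness_plurality[where M = M and L = L and B = B and N = N and g = g and r = r and Q = Q])
    show "M > 0" using M by simp
    show "n + M \<in> B \<longleftrightarrow> n \<in> B" for n using perB by (simp add: M_def)
    fix s assume s: "s \<in> F \<union> T"
    have "\<forall>n\<in>B. n + c s \<notin> B"
      using Bm Bs A by (auto simp: c_def)
    moreover have "card {i. i < N \<and> \<not> near_integer (of_int s * \<gamma> i - of_int (c s) / of_int M) e} \<le> r"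
    proof (cases "s \<in> F")
      case True
      then have "{i. i < N \<and> \<not> near_integer (of_int s * \<gamma> i - of_int (c s) / of_int M) e} = {}"
        using nearF by (auto simp: c_def)
      then show ?thesis by (simp only: card.empty)
    next
      case False
      then have "s \<in> G" "real_of_int (c s) / of_int M = 1 / 2"
        using s T(2) m by (auto simp: c_def M_def)
      then show ?thesis by (simp add: G_def)
    qed
    moreover have "card {i. i < N \<and> \<not> near_integer (of_int s * (of_int (g i) / of_int Q) - of_int (c s) / of_int M) e}
        \<le> card {i. i < N \<and> \<not> near_integer (of_int s * \<gamma> i - of_int (c s) / of_int M) e}"
      using g[OF s] by (intro card_mono) auto
    ultimately show "\<exists>c. (\<forall>b\<in>B. b + c \<notin> B) \<and>
      card {i. i < N \<and> \<not> near_integer (of_int s * (of_int (g i) / of_int Q) - of_int c / of_int M) (1 / of_int (M * L))} \<le> r"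
      unfolding e_def by (intro exI[of _ "c s"]) linarith
  qed (use L Q dens in auto)
  moreover have "\<exists>s\<in>T. \<forall>j<r. near_integer (of_int (s - n) * \<alpha> j) d" if "\<bar>n\<bar> \<le> b" for n and \<alpha> :: "nat \<Rightarrow> real"
    using hit[of n \<alpha>] that by (force simp: T_def abs_le_iff)
  ultimately show ?thesis using that[of T] T by (auto simp: G_def)
qed

section \<open>Passage to the limit\<close>

text \<open>The even residues below \<open>m - 1\<close> modulo \<open>m = 2 * k + 1\<close> have
  density \<open>k / (2 * k + 1)\<close>, which tends to \<open>1 / 2\<close>. The even residue
  \<open>m - 1\<close> is left out because 0 follows it cyclically.\<close>

lemma modular_witness_one:
  assumes "\<delta> < 1 / 2"
  shows "modular_witness \<delta> {1}"
proof -
  \<comment> \<open>This is \<open>\<delta> * (2 * k + 1) < k\<close> solved for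
    \<open>k\<close>.\<close>
  obtain k :: nat where k: "\<delta> / (1 - 2 * \<delta>) < real k" using reals_Archimedean2 by blast
  define m where "m = 2 * int k + 1"
  define A where "A = {n. even (n mod m) \<and> n mod m < m - 1}"
  have m: "m > 0" "odd m" by (auto simp: m_def)
  have "A \<inter> {0..<m} = (\<lambda>i. 2 * i) ` {0..<int k}"
    by (auto simp: A_def m_def elim!: evenE)
  then have "card (A \<inter> {0..<m}) = k" by (simp add: card_image inj_on_def)
  moreover have "\<delta> * of_int m < real k"
    using k assms by (simp add: m_def field_simps)
  moreover have "n + 1 \<notin> A" if "n \<in> A" for n
  proof -
    have "(n + 1) mod m = (n mod m + 1) mod m" by (simp add: mod_add_left_eq)
    also have "\<dots> = n mod m + 1" using that m by (intro mod_pos_pos_trivial) (auto simp: A_def)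
    finally show ?thesis using that by (simp add: A_def)
  qed
  moreover have "n + m \<in> A \<longleftrightarrow> n \<in> A" for n by (simp add: A_def)
  ultimately show ?thesis
    unfolding modular_witness_def using m by (intro exI[of _ m] exI[of _ A]) simp
qed

text \<open>Translate by a minimum of the discrepancy \<open>n \<mapsto> card (A \<inter> {1..n}) - \<delta> * n\<close>, which exists since
  the discrepancy increases over each period.\<close>

lemma modular_witness_initial_segments:
  assumes "modular_witness \<delta> F"
  shows "\<exists>A. (\<forall>n\<in>A. \<forall>s\<in>F. n + s \<notin> A) \<and> (\<forall>n. \<delta> * real n \<le> real (card (A \<inter> {1..int n})))"
proof -
  obtain m A where m: "m > 0" and per: "\<And>n. n + m \<in> A \<longleftrightarrow> n \<in> A"
    and dens: "\<delta> * of_int m < real (card (A \<inter> {0..<m}))"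
    and A: "\<And>n s. n \<in> A \<Longrightarrow> s \<in> F \<Longrightarrow> n + s \<notin> A"
    using assms unfolding modular_witness_def by blast
  define M where "M = nat m"
  have M: "M > 0" "int M = m" using m by (auto simp: M_def)
  define G where "G n = real (card (A \<inter> {1..int n})) - \<delta> * real n" for n
  have split: "card (A \<inter> {1..int (a + b)}) = card (A \<inter> {1..int a}) + card (A \<inter> {int a + 1..int (a + b)})" for a b
  proof -
    have "A \<inter> {1..int (a + b)} = (A \<inter> {1..int a}) \<union> (A \<inter> {int a + 1..int (a + b)})" by auto
    then show ?thesis by (simp only:) (rule card_Un_disjoint; auto)
  qed
  have step: "G (n + M) \<ge> G n" for n
  proof -
    have "{int n + 1..int (n + M)} = {int n + 1..<int n + 1 + m}" using M by auto
    then have "card (A \<inter> {int n + 1..int (n + M)}) = card (A \<inter> {0..<m})"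
      using card_periodic_window[OF per m, of "int n + 1"] by (simp only:)
    moreover have "\<delta> * real (n + M) = \<delta> * real n + \<delta> * of_int m"
      by (simp add: distrib_left flip: M(2))
    ultimately show ?thesis using dens unfolding G_def split by simp
  qed
  have "G (r + q * M) \<ge> G r" for q r
  proof (induction q)
    case (Suc q)
    then show ?case using step[of "r + q * M"] by (simp add: add_ac)
  qed simp
  then have modM: "G n \<ge> G (n mod M)" for n
    by (metis mod_mult_div_eq mult.commute)
  obtain x where x: "x < M" "\<And>n. n < M \<Longrightarrow> G x \<le> G n"
  proof -
    have "Min (G ` {..<M}) \<in> G ` {..<M}" using M by (intro Min_in) auto
    then obtain x where "x < M" "G x = Min (G ` {..<M})" by auto
    then show ?thesis using that[of x] by simp
  qed
  have min: "G x \<le> G n" for n using x(2)[of "n mod M"] modM[of n] M by force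
  define A' where "A' = {n. n + int x \<in> A}"
  have "\<delta> * real n \<le> real (card (A' \<inter> {1..int n}))" for n
  proof -
    have "A \<inter> {int x + 1..int (x + n)} = (\<lambda>i. i + int x) ` (A' \<inter> {1..int n})"
      by (auto simp: A'_def image_iff intro!: bexI[of _ "i - int x" for i])
    then have "card (A \<inter> {int x + 1..int (x + n)}) = card (A' \<inter> {1..int n})"
      by (simp add: card_image inj_on_def)
    then have "real (card (A \<inter> {1..int (x + n)})) = real (card (A \<inter> {1..int x})) + real (card (A' \<inter> {1..int n}))"
      unfolding split by simp
    then show ?thesis using min[of "x + n"] by (simp add: G_def algebra_simps)
  qed
  moreover have "n + s \<notin> A'" if "n \<in> A'" "s \<in> F" for n s
    using A[of "n + int x" s] that by (simp add: A'_def algebra_simps)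
  ultimately show ?thesis by blast
qed

text \<open>Each condition on an indicator function involves finitely many coordinates, so the
  conditions for \<open>f k\<close> cut out a closed set in the compact space of 0-1 sequences, and
  these sets decrease with \<open>k\<close>. The bounds on initial segments are uniform in
  \<open>k\<close> and therefore pass to the limit.\<close>

lemma initial_segments_compactness:
  fixes f :: "nat \<Rightarrow> int set"
  assumes mono: "\<And>k. f k \<subseteq> f (Suc k)"
    and wit: "\<And>k. \<exists>A. (\<forall>n\<in>A. \<forall>s\<in>f k. n + s \<notin> A) \<and> (\<forall>n. \<delta> * real n \<le> real (card (A \<inter> {1..int n})))"
  obtains A where "\<And>n s. n \<in> A \<Longrightarrow> s \<in> (\<Union>k. f k) \<Longrightarrow> n + s \<notin> A"
    "\<And>n. \<delta> * real n \<le> real (card (A \<inter> {1..int n}))"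
proof -
  let ?C = "PiE UNIV (\<lambda>_. {0, 1}) :: (int \<Rightarrow> real) set"
  have "compactin (product_topology (\<lambda>_. euclidean) UNIV) (PiE UNIV (\<lambda>_::int. {0, 1::real}))"
    by (simp add: compactin_PiE)
  then have C: "compact ?C" by (simp add: euclidean_product_topology)
  define X where "X k = {x :: int \<Rightarrow> real. (\<forall>n s. s \<in> f k \<longrightarrow> x n * x (n + s) = 0) \<and>
      (\<forall>n. \<delta> * real n \<le> (\<Sum>i\<in>{1..int n}. x i))}" for k
  have closed: "closed (X k)" for k
    unfolding X_def
    by (intro closed_Collect_conj closed_Collect_all closed_Collect_imp open_Collect_const closed_Collect_eq closed_Collect_le
        continuous_intros continuous_on_product_coordinates)
  have sum_ind: "(\<Sum>i\<in>{1..int n}. indicator A i) = real (card (A \<inter> {1..int n}))" for A n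
    by (simp add: indicator_def Int_commute)
  have fmono: "f j \<subseteq> f k" if "j \<le> k" for j k using lift_Suc_mono_le[of f, OF mono that] .
  have fip: "?C \<inter> \<Inter>(X ` J) \<noteq> {}" if "finite J" for J
  proof -
    \<comment> \<open>The largest index in \<open>J\<close> carries the strongest avoidance
      condition; inserting 0 covers the case of empty \<open>J\<close>.\<close>
    obtain A where A: "\<forall>n\<in>A. \<forall>s\<in>f (Max (insert 0 J)). n + s \<notin> A"
      "\<forall>n. \<delta> * real n \<le> real (card (A \<inter> {1..int n}))" using wit by blast
    have "indicator A \<in> ?C" by (auto simp: indicator_def)
    moreover have "indicator A \<in> X k" if "k \<in> J" for k
    proof -
      have "f k \<subseteq> f (Max (insert 0 J))" using that \<open>finite J\<close> by (intro fmono Max_ge) auto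
      then show ?thesis
        unfolding X_def mem_Collect_eq sum_ind using A by (auto simp: indicator_def)
    qed
    ultimately show ?thesis by blast
  qed
  have "?C \<inter> \<Inter>(X ` UNIV) \<noteq> {}"
    by (rule compact_imp_fip_image[OF C closed fip])
  then obtain x where x: "x \<in> ?C" "\<And>k. x \<in> X k" by blast
  define A where "A = {n. x n = 1}"
  have x01: "x n = 0 \<or> x n = 1" for n using x(1) by (auto simp: PiE_iff)
  have xA: "x = indicator A" using x01 by (auto simp: A_def indicator_def fun_eq_iff)
  show ?thesis
  proof (rule that[of A])
    fix n s assume n: "n \<in> A" and "s \<in> (\<Union>k. f k)"
    then obtain k where "s \<in> f k" by blast
    then have "x n * x (n + s) = 0" using x(2)[of k] by (simp add: X_def)
    then show "n + s \<notin> A" using n by (simp add: A_def)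
  next
    fix n
    have "\<delta> * real n \<le> (\<Sum>i\<in>{1..int n}. x i)" using x(2)[of 0] by (simp add: X_def)
    then show "\<delta> * real n \<le> real (card (A \<inter> {1..int n}))" by (simp only: xA sum_ind)
  qed
qed

text \<open>For every \<open>n > 0\<close> the supremum over windows is at least its value at
  \<open>k = 0\<close>.\<close>

lemma upper_banach_density_ge:
  assumes "\<And>n. \<delta> * real n \<le> real (card (A \<inter> {1..int n}))"
  shows "ereal \<delta> \<le> upper_banach_density A"
proof -
  let ?g = "\<lambda>n k. ereal (real (card (A \<inter> {k + 1..k + int n})) / real n)"
  have "ereal \<delta> \<le> (SUP k. ?g n k)" if "n > 0" for n
  proof -
    have "ereal \<delta> \<le> ?g n 0" using assms[of n] that by (simp add: field_simps)
    also have "\<dots> \<le> (SUP k. ?g n k)" by (rule SUP_upper) simp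
    finally show ?thesis .
  qed
  then have "eventually (\<lambda>n. ereal \<delta> \<le> (SUP k. ?g n k)) sequentially"
    using eventually_gt_at_top[of 0] by (rule eventually_mono[rotated])
  then have "ereal \<delta> \<le> liminf (\<lambda>n. SUP k. ?g n k)" by (rule Liminf_bounded)
  also have "\<dots> \<le> limsup (\<lambda>n. SUP k. ?g n k)" by (rule Liminf_le_Limsup) simp
  finally show ?thesis unfolding upper_banach_density_def .
qed

text \<open>Dependent choice starting from \<open>{1}\<close>: at stage \<open>k\<close> the rank,
  the range of base points and the inverse radius all grow, so every Bohr neighbourhood is
  eventually treated.\<close>

lemma exists_bohr_dense_nonrecurrent_chain:
  assumes S: "bohr_dense S" and \<delta>: "0 \<le> \<delta>" "\<delta> < 1 / 2"
  obtains f :: "nat \<Rightarrow> int set" where "\<And>k. modular_witness \<delta> (f k)" "\<And>k. f k \<subseteq> f (Suc k)"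
    "\<And>k n (\<alpha> :: nat \<Rightarrow> real). \<bar>n\<bar> \<le> int k \<Longrightarrow>
      \<exists>s\<in>f (Suc k) \<inter> S. \<forall>j<k. near_integer (of_int (s - n) * \<alpha> j) (1 / real (Suc k))"
proof -
  let ?P = "\<lambda>X. finite X \<and> 1 \<in> X \<and> modular_witness \<delta> X"
  let ?Q = "\<lambda>k X Y. X \<subseteq> Y \<and> (\<forall>n. \<bar>n\<bar> \<le> int k \<longrightarrow> (\<forall>\<alpha> :: nat \<Rightarrow> real.
    \<exists>s\<in>Y \<inter> S. \<forall>j<k. near_integer (of_int (s - n) * \<alpha> j) (1 / real (Suc k))))"
  have "\<exists>f. \<forall>k. ?P (f k) \<and> ?Q k (f k) (f (Suc k))"
  proof (rule dependent_nat_choice)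
    show "\<exists>X. ?P X" using modular_witness_one[OF \<delta>(2)] by (intro exI[of _ "{1}"]) simp
    fix X k assume X: "?P X"
    have pos: "1 / real (Suc k) > 0" by simp
    obtain T where T: "finite T" "T \<subseteq> S" "modular_witness \<delta> (X \<union> T)"
      and hit: "\<And>n (\<alpha> :: nat \<Rightarrow> real). \<bar>n\<bar> \<le> int k \<Longrightarrow>
        \<exists>s\<in>T. \<forall>j<k. near_integer (of_int (s - n) * \<alpha> j) (1 / real (Suc k))"
      using extend_modular_witness[OF S \<delta>(1), of X "1 / real (Suc k)" "int k" k] X pos by blast
    have "?Q k X (X \<union> T)"
    proof (intro conjI allI impI)
      fix n and \<alpha> :: "nat \<Rightarrow> real"
      assume "\<bar>n\<bar> \<le> int k"
      then obtain s where "s \<in> T" "\<forall>j<k. near_integer (of_int (s - n) * \<alpha> j) (1 / real (Suc k))"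
        using hit by blast
      then show "\<exists>s\<in>(X \<union> T) \<inter> S. \<forall>j<k. near_integer (of_int (s - n) * \<alpha> j) (1 / real (Suc k))"
        using T(2) by blast
    qed simp
    then show "\<exists>Y. ?P Y \<and> ?Q k X Y" using X T by (intro exI[of _ "X \<union> T"]) simp
  qed
  then obtain f where f: "\<And>k. ?P (f k) \<and> ?Q k (f k) (f (Suc k))" by blast
  show ?thesis
  proof (rule that[of f])
    show "modular_witness \<delta> (f k)" "f k \<subseteq> f (Suc k)" for k using f[of k] by blast+
    show "\<exists>s\<in>f (Suc k) \<inter> S. \<forall>j<k. near_integer (of_int (s - n) * \<alpha> j) (1 / real (Suc k))"
      if "\<bar>n\<bar> \<le> int k" for k n and \<alpha> :: "nat \<Rightarrow> real"
      using f[of k] that by blast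
  qed
qed

theorem theorem1p3:
  fixes S :: "int set" and \<delta> :: real
  assumes "bohr_dense S" and "0 \<le> \<delta>" and "\<delta> < 1 / 2"
  shows "\<exists>S'. S' \<subseteq> S \<and> bohr_dense S' \<and> nonrecurrent \<delta> S'"
proof -
  \<comment> \<open>The limit set only has density at least \<open>\<epsilon>\<close>; taking
    \<open>\<epsilon>\<close> midway between \<open>\<delta>\<close> and \<open>1 / 2\<close>
    restores the strict inequality.\<close>
  define \<epsilon> where "\<epsilon> = (\<delta> + 1 / 2) / 2"
  have \<epsilon>: "0 \<le> \<epsilon>" "\<epsilon> < 1 / 2" "\<delta> < \<epsilon>" using assms by (auto simp: \<epsilon>_def)
  obtain f :: "nat \<Rightarrow> int set" where wit: "\<And>k. modular_witness \<epsilon> (f k)" and mono: "\<And>k. f k \<subseteq> f (Suc k)"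
    and hit: "\<And>k n (\<alpha> :: nat \<Rightarrow> real). \<bar>n\<bar> \<le> int k \<Longrightarrow>
      \<exists>s\<in>f (Suc k) \<inter> S. \<forall>j<k. near_integer (of_int (s - n) * \<alpha> j) (1 / real (Suc k))"
    using exists_bohr_dense_nonrecurrent_chain[OF assms(1) \<epsilon>(1,2)] by metis
  \<comment> \<open>The sets \<open>f k\<close> contain the initial element 1, which may lie outside
    \<open>S\<close>; hence the intersection.\<close>
  define S' where "S' = (\<Union>k. f k) \<inter> S"
  have "bohr_dense S'"
  proof (rule bohr_denseI)
    fix n e r and \<alpha> :: "nat \<Rightarrow> real"
    assume e: "(e :: real) > 0"
    obtain K :: nat where K: "1 / real (Suc K) < e" using nat_approx_posE[OF e] by blast
    \<comment> \<open>The stage must exceed the rank \<open>r\<close>, reach the base point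
      \<open>n\<close> and have radius below \<open>e\<close>.\<close>
    define k where "k = max r (max (nat \<bar>n\<bar>) K)"
    have "nat \<bar>n\<bar> \<le> k" by (simp add: k_def)
    then have nk: "\<bar>n\<bar> \<le> int k" by linarith
    have "1 / real (Suc k) \<le> 1 / real (Suc K)" by (simp add: k_def frac_le)
    then have ke: "1 / real (Suc k) < e" using K by linarith
    obtain s where s: "s \<in> f (Suc k) \<inter> S" "\<forall>j<k. near_integer (of_int (s - n) * \<alpha> j) (1 / real (Suc k))"
      using hit[OF nk, of \<alpha>] by blast
    have "near_integer (of_int (s - n) * \<alpha> j) e" if "j < r" for j
    proof -
      have "j < k" using that by (simp add: k_def)
      then obtain h :: int where "\<bar>of_int (s - n) * \<alpha> j - of_int h\<bar> < 1 / real (Suc k)"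
        using s(2) unfolding near_integer_def by blast
      then show ?thesis unfolding near_integer_def using ke less_trans by blast
    qed
    then show "\<exists>s\<in>S'. \<forall>j<r. near_integer (of_int (s - n) * \<alpha> j) e"
      using s(1) by (auto simp: S'_def)
  qed
  moreover have "nonrecurrent \<delta> S'"
  proof -
    obtain A where A: "\<And>n s. n \<in> A \<Longrightarrow> s \<in> (\<Union>k. f k) \<Longrightarrow> n + s \<notin> A"
      and dens: "\<And>n. \<epsilon> * real n \<le> real (card (A \<inter> {1..int n}))"
      using initial_segments_compactness[of f \<epsilon>, OF mono modular_witness_initial_segments[OF wit]] by metis
    have "ereal \<delta> < ereal \<epsilon>" using \<epsilon>(3) by simp
    also have "\<dots> \<le> upper_banach_density A" by (rule upper_banach_density_ge[OF dens])
    finally have "upper_banach_density A > ereal \<delta>" .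
    moreover have "{a - b | a b. a \<in> A \<and> b \<in> A} \<inter> S' = {}"
    proof (rule ccontr)
      assume "\<not> ?thesis"
      then obtain a b where "a \<in> A" "b \<in> A" "a - b \<in> (\<Union>k. f k)" unfolding S'_def by blast
      then show False using A[of b "a - b"] by simp
    qed
    ultimately show ?thesis unfolding nonrecurrent_def by blast
  qed
  moreover have "S' \<subseteq> S" by (simp add: S'_def)
  ultimately show ?thesis by blast
qed

end
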